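(* Let $H$ be a nonzero complex Hilbert space, let $\Omega\subset H$ be a bounded domain and let $u\in\mathcal{PSH}(\Omega)\cap C^2(\overline\Omega)$ be bounded on $\overline\Omega$. Assume: (1) $u\le\|z\|^2$ on $\partial\Omega$; (2) for every $z\in\Omega$ and every unit vector $x\in H$, \[ 1=\Delta_x(I)=\Delta_x(D'D''\|z\|^2)\le\Delta_x(D'D''u(z)). \] Then $u-\|z\|^2$ is plurisubharmonic and nonpositive on $\Omega$.
   Context: The inner product of $H$ is linear in the first variable. Plurisubharmonic: for $\Omega\subset H$ open, $\mathcal{PSH}(\Omega)$ is the set of upper semicontinuous $u:\Omega\to[-\infty,\infty)$, not identically $-\infty$ on any component of $\Omega$, such that $u(z)\le\frac1{2\pi}\int_0^{2\pi}u(z+e^{i\theta}h)\,d\theta$ whenever $z\in\Omega$, $h\in H$ and $z+\lambda h\in\Omega$ for all $|\lambda|\le1$. $C^2(\overline\Omega)$ denotes functions on $\overline\Omega$ of class $C^2$ up to the boundary (of class $C^2$ in $\Omega$, with the function and its derivatives up to order two extending continuously to $\overline\Omega$). Levi form: for a $C^2$ function $u$ with second real Fréchet differential $D^2u(a)$, $4D'D''u(a)(s,t)=D^2u(a)(s,t)+D^2u(a)(is,it)+iD^2u(a)(s,it)-iD^2u(a)(is,t)$; this form is identified with the bounded operator $D'D''u(a)$ given by $\langle D'D''u(a)s,t\rangle=D'D''u(a)(s,t)$ (so $D'D''\|z\|^2=I$, the identity). For $u$ plurisubharmonic this operator is positive. Fujii--Seo determinant: for a bounded positive operator $A\ge0$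 and a unit vector $x$, $\Delta_x(A):=\exp\bigl(\lim_{\varepsilon\to0^+}\langle\log(A+\varepsilon I)x,x\rangle\bigr)$, with $\exp(-\infty)=0$ (this equals $\exp(\langle(\log A)x,x\rangle)$ if $A$ is invertible). *)

theory Defs
  imports "HOL-Analysis.Analysis" "HOL-Computational_Algebra.Polynomial"
begin

section \<open>Complex Hilbert spaces\<close>

text \<open>The underlying real inner product is the real part of the complex one, which makes
  the norm, the topology and the real Frechet derivatives those of the library. Positive
  definiteness of the complex inner product is inherited from the real one. The complex inner
  product is linear in its first argument.\<close>

class complex_hilbert_space = real_inner + banach +
  fixes scaleC :: "complex \<Rightarrow> 'a \<Rightarrow> 'a" (infixr "*\<^sub>C" 75)
    and cinner :: "'a \<Rightarrow> 'a \<Rightarrow> complex"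
  assumes scaleC_add_right: "c *\<^sub>C (x + y) = c *\<^sub>C x + c *\<^sub>C y"
    and scaleC_add_left: "(c + d) *\<^sub>C x = c *\<^sub>C x + d *\<^sub>C x"
    and scaleC_scaleC: "c *\<^sub>C d *\<^sub>C x = (c * d) *\<^sub>C x"
    and scaleR_scaleC: "r *\<^sub>R x = complex_of_real r *\<^sub>C x"
    and cinner_commute: "cinner x y = cnj (cinner y x)"
    and cinner_add_left: "cinner (x + y) z = cinner x z + cinner y z"
    and cinner_scaleC_left: "cinner (c *\<^sub>C x) y = c * cinner x y"
    and inner_eq_Re_cinner: "inner x y = Re (cinner x y)"

section \<open>Plurisubharmonic functions\<close>

text \<open>The mean of an extended real function over the circle, as the difference of the
  integrals of the positive and negative parts (\<^const>\<open>e2ennreal\<close> truncates negative values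
  to 0). For an upper semicontinuous function with values below infinity the first integral is
  finite, so the mean is a well-defined element of the interval from minus infinity to
  infinity.\<close>

definition circle_mean :: "('a::complex_hilbert_space \<Rightarrow> ereal) \<Rightarrow> 'a \<Rightarrow> 'a \<Rightarrow> ereal" where
  "circle_mean u z h =
     (enn2ereal (\<integral>\<^sup>+\<theta>\<in>{0..2*pi}. e2ennreal (u (z + cis \<theta> *\<^sub>C h)) \<partial>lborel)
      - enn2ereal (\<integral>\<^sup>+\<theta>\<in>{0..2*pi}. e2ennreal (- u (z + cis \<theta> *\<^sub>C h)) \<partial>lborel))
     / ereal (2 * pi)"

definition upper_semicontinuous_on :: "'a::topological_space set \<Rightarrow> ('a \<Rightarrow> ereal) \<Rightarrow> bool" where
  "upper_semicontinuous_on S u \<longleftrightarrow>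
     (\<forall>c. openin (top_of_set S) {z \<in> S. u z < c})"

definition psh_on :: "'a::complex_hilbert_space set \<Rightarrow> ('a \<Rightarrow> ereal) \<Rightarrow> bool" where
  "psh_on \<Omega> u \<longleftrightarrow>
     (\<forall>z\<in>\<Omega>. u z < \<infinity>) \<and>
     upper_semicontinuous_on \<Omega> u \<and>
     (\<forall>C\<in>components \<Omega>. \<exists>z\<in>C. u z \<noteq> -\<infinity>) \<and>
     (\<forall>z\<in>\<Omega>. \<forall>h. (\<forall>c. cmod c \<le> 1 \<longrightarrow> z + c *\<^sub>C h \<in> \<Omega>) \<longrightarrow> u z \<le> circle_mean u z h)"

section \<open>Differentials and the Levi form\<close>

definition frechet_diff ::
    "('a::real_normed_vector \<Rightarrow> 'b::real_normed_vector) \<Rightarrow> 'a \<Rightarrow> 'a \<Rightarrow>\<^sub>L 'b" where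
  "frechet_diff u a = Blinfun (frechet_derivative u (at a))"

definition frechet_diff2 ::
    "('a::real_normed_vector \<Rightarrow> 'b::real_normed_vector) \<Rightarrow> 'a \<Rightarrow> 'a \<Rightarrow>\<^sub>L 'a \<Rightarrow>\<^sub>L 'b" where
  "frechet_diff2 u = frechet_diff (frechet_diff u)"

text \<open>Class \<open>C\<^sup>2\<close> up to the boundary of the open set \<open>\<Omega>\<close>. Values of \<open>u\<close> outside the closure
  are irrelevant. Continuity of the differentials in \<open>\<Omega>\<close> follows from the existence of
  continuous extensions to the closure.\<close>

definition C2_on_closure ::
    "'a::real_normed_vector set \<Rightarrow> ('a \<Rightarrow> 'b::real_normed_vector) \<Rightarrow> bool" where
  "C2_on_closure \<Omega> u \<longleftrightarrow>
     (\<forall>z\<in>\<Omega>. u differentiable (at z)) \<and>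
     (\<forall>z\<in>\<Omega>. frechet_diff u differentiable (at z)) \<and>
     continuous_on (closure \<Omega>) u \<and>
     (\<exists>g. continuous_on (closure \<Omega>) g \<and> (\<forall>z\<in>\<Omega>. g z = frechet_diff u z)) \<and>
     (\<exists>g. continuous_on (closure \<Omega>) g \<and> (\<forall>z\<in>\<Omega>. g z = frechet_diff2 u z))"

definition levi_form ::
    "('a::complex_hilbert_space \<Rightarrow> real) \<Rightarrow> 'a \<Rightarrow> 'a \<Rightarrow> 'a \<Rightarrow> complex" where
  "levi_form u a s t =
     (let D = (\<lambda>v w. complex_of_real (blinfun_apply (blinfun_apply (frechet_diff2 u a) v) w))
      in (D s t + D (\<i> *\<^sub>C s) (\<i> *\<^sub>C t) + \<i> * D s (\<i> *\<^sub>C t) - \<i> * D (\<i> *\<^sub>C s) t) / 4)"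

text \<open>Bounded operators are taken in the library type of bounded real-linear maps. The operator
  below is complex-linear automatically, because the form is complex-linear in its first
  argument.\<close>

definition levi_op :: "('a::complex_hilbert_space \<Rightarrow> real) \<Rightarrow> 'a \<Rightarrow> 'a \<Rightarrow>\<^sub>L 'a" where
  "levi_op u a = (THE A. \<forall>s t. cinner (blinfun_apply A s) t = levi_form u a s t)"

section \<open>Continuous functional calculus and the Fujii--Seo determinant\<close>

text \<open>The inverse of a complex-linear operator is complex-linear, so for such \<open>A\<close> it does not
  matter that \<open>B\<close> ranges over real-linear operators.\<close>

definition op_spectrum :: "('a::complex_hilbert_space \<Rightarrow>\<^sub>L 'a) \<Rightarrow> complex set" where
  "op_spectrum A =
     {c. \<not> (\<exists>B :: 'a \<Rightarrow>\<^sub>L 'a. \<forall>x.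
            blinfun_apply B (blinfun_apply A x - c *\<^sub>C x) = x \<and>
            blinfun_apply A (blinfun_apply B x) - c *\<^sub>C blinfun_apply B x = x)}"

definition poly_op :: "real poly \<Rightarrow> ('a::real_normed_vector \<Rightarrow>\<^sub>L 'a) \<Rightarrow> 'a \<Rightarrow>\<^sub>L 'a" where
  "poly_op p A = (\<Sum>i\<le>degree p. coeff p i *\<^sub>R (((o\<^sub>L) A ^^ i) id_blinfun))"

text \<open>Continuous functional calculus of a bounded self-adjoint operator \<open>A\<close> (whose spectrum is
  a compact subset of the reals) for a real function continuous on the spectrum: the norm limit
  of \<open>p n (A)\<close> for polynomials \<open>p n\<close> converging to \<open>f\<close> uniformly on the spectrum.\<close>

definition op_fun :: "(real \<Rightarrow> real) \<Rightarrow> ('a::complex_hilbert_space \<Rightarrow>\<^sub>L 'a) \<Rightarrow> 'a \<Rightarrow>\<^sub>L 'a" where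
  "op_fun f A =
     (THE T. \<forall>p :: nat \<Rightarrow> real poly.
        uniform_limit {r. complex_of_real r \<in> op_spectrum A} (\<lambda>n. poly (p n)) f sequentially
        \<longrightarrow> (\<lambda>n. poly_op (p n) A) \<longlonglongrightarrow> T)"

text \<open>The quantity \<open>\<langle>log (A + \<epsilon> I) x, x\<rangle>\<close> is real because the logarithm is self-adjoint, and
  it is monotone in \<open>\<epsilon>\<close>; its limit is taken in the extended reals and is never plus
  infinity.\<close>

definition fujii_seo_det :: "'a::complex_hilbert_space \<Rightarrow> ('a \<Rightarrow>\<^sub>L 'a) \<Rightarrow> real" where
  "fujii_seo_det x A =
     (let l = Lim (at_right 0) (\<lambda>\<epsilon>. ereal (Re (cinner
                (blinfun_apply (op_fun ln (A + \<epsilon> *\<^sub>R id_blinfun)) x) x)))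
      in if l = -\<infinity> then 0 else exp (real_of_ereal l))"

section \<open>The identities \<open>\<Delta>\<^sub>x(I) = 1\<close> and \<open>D'D''\<parallel>z\<parallel>\<^sup>2 = I\<close>\<close>

lemma cinner_Im: "Im (cinner x y) = inner x (\<i> *\<^sub>C (y :: 'a::complex_hilbert_space))"
proof -
  have "cinner x (\<i> *\<^sub>C y) = cnj (\<i> * cinner y x)"
    by (metis cinner_commute cinner_scaleC_left)
  also have "\<dots> = - \<i> * cinner x y"
    using cinner_commute[of x y] by simp
  finally show ?thesis by (simp add: inner_eq_Re_cinner)
qed

lemma frechet_diff2_norm_sq:
  fixes a s t :: "'a::real_inner"
  shows "blinfun_apply (blinfun_apply (frechet_diff2 (\<lambda>w. (norm w)\<^sup>2) a) s) t = 2 * inner s t"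
proof -
  have 1: "frechet_diff (\<lambda>w::'a. (norm w)\<^sup>2) = (\<lambda>z. 2 *\<^sub>R blinfun_inner_right z)"
  proof
    fix z :: 'a
    have "((\<lambda>w::'a. (norm w)\<^sup>2) has_derivative (\<lambda>h. 2 * inner z h)) (at z)"
      unfolding power2_norm_eq_inner
      by (auto intro!: derivative_eq_intros simp: inner_commute)
    then have "frechet_derivative (\<lambda>w::'a. (norm w)\<^sup>2) (at z) = (\<lambda>h. 2 * inner z h)"
      by (metis frechet_derivative_at)
    also have "\<dots> = blinfun_apply (2 *\<^sub>R blinfun_inner_right z)"
      by (auto simp: scaleR_blinfun.rep_eq)
    finally show "frechet_diff (\<lambda>w::'a. (norm w)\<^sup>2) z = 2 *\<^sub>R blinfun_inner_right z"
      by (simp add: frechet_diff_def blinfun_apply_inverse)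
  qed
  have bl: "bounded_linear (\<lambda>z::'a. 2 *\<^sub>R blinfun_inner_right z)"
    by (rule bounded_linear_compose[OF bounded_linear_scaleR_right])
      (rule bounded_linear_blinfun_inner_right)
  then have "frechet_derivative (\<lambda>z::'a. 2 *\<^sub>R blinfun_inner_right z) (at a)
             = (\<lambda>z. 2 *\<^sub>R blinfun_inner_right z)"
    by (metis bounded_linear_imp_has_derivative frechet_derivative_at)
  then have "frechet_diff2 (\<lambda>w::'a. (norm w)\<^sup>2) a = Blinfun (\<lambda>z. 2 *\<^sub>R blinfun_inner_right z)"
    by (simp add: frechet_diff2_def 1) (simp add: frechet_diff_def)
  then show ?thesis
    by (simp add: bounded_linear_Blinfun_apply[OF bl] scaleR_blinfun.rep_eq)
qed

lemma levi_op_norm_sq: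
  fixes a :: "'a::complex_hilbert_space"
  shows "levi_op (\<lambda>w. (norm w)\<^sup>2) a = id_blinfun"
proof -
  have L: "levi_form (\<lambda>w. (norm w)\<^sup>2) a s t = cinner s t" for s t :: 'a
  proof -
    have a: "inner (\<i> *\<^sub>C s) (\<i> *\<^sub>C t) = Re (cinner s t)"
      by (simp add: cinner_Im[symmetric] cinner_scaleC_left)
    have b: "inner (\<i> *\<^sub>C s) t = - Im (cinner s t)"
      by (simp add: inner_eq_Re_cinner cinner_scaleC_left)
    have c: "inner s (\<i> *\<^sub>C t) = Im (cinner s t)"
      by (simp add: cinner_Im)
    have d: "(complex_of_real (2 * p) + complex_of_real (2 * p) + \<i> * complex_of_real (2 * q)
              - \<i> * complex_of_real (2 * - q)) / 4 = Complex p q" for p q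
      by (simp add: complex_eq_iff)
    show ?thesis
      unfolding levi_form_def Let_def frechet_diff2_norm_sq a b c inner_eq_Re_cinner[of s t] d
      by (rule complex_surj)
  qed
  show ?thesis
    unfolding levi_op_def L
  proof (rule the_equality)
    fix A :: "'a \<Rightarrow>\<^sub>L 'a"
    assume A: "\<forall>s t. cinner (blinfun_apply A s) t = cinner s t"
    show "A = id_blinfun"
    proof (rule blinfun_eqI)
      fix s :: 'a
      have "inner (blinfun_apply A s) t = inner s t" for t
        by (simp add: inner_eq_Re_cinner A)
      then show "blinfun_apply A s = blinfun_apply id_blinfun s"
        using vector_eq_rdot[of "blinfun_apply A s" s] by simp
    qed
  qed auto
qed

lemma poly_op_scaleR_id:
  "poly_op p (c *\<^sub>R id_blinfun) = poly p c *\<^sub>R (id_blinfun :: 'a::real_normed_vector \<Rightarrow>\<^sub>L 'a)"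
proof -
  have "((o\<^sub>L) (c *\<^sub>R id_blinfun) ^^ i) id_blinfun = c ^ i *\<^sub>R (id_blinfun :: 'a \<Rightarrow>\<^sub>L 'a)" for i
    by (induction i) (auto intro!: blinfun_eqI simp: scaleR_blinfun.rep_eq)
  then show ?thesis
    by (simp add: poly_op_def poly_altdef scaleR_sum_left)
qed

lemma op_spectrum_scaleR_id:
  fixes x :: "'a::complex_hilbert_space"
  assumes "x \<noteq> 0"
  shows "complex_of_real c \<in> op_spectrum (c *\<^sub>R (id_blinfun :: 'a \<Rightarrow>\<^sub>L 'a))"
  using assms
  by (auto simp: op_spectrum_def scaleR_blinfun.rep_eq scaleR_scaleC[symmetric] blinfun.zero_right)

lemma op_spectrum_scaleR_id_subset:
  "{r. complex_of_real r \<in> op_spectrum (c *\<^sub>R (id_blinfun :: 'a::complex_hilbert_space \<Rightarrow>\<^sub>L 'a))} \<subseteq> {c}"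
proof
  fix r assume "r \<in> {r. complex_of_real r \<in> op_spectrum (c *\<^sub>R (id_blinfun :: 'a \<Rightarrow>\<^sub>L 'a))}"
  then have *: "\<not> (\<forall>x. blinfun_apply B (c *\<^sub>R x - r *\<^sub>R x) = x \<and>
      c *\<^sub>R blinfun_apply B x - r *\<^sub>R blinfun_apply B x = x)" for B :: "'a \<Rightarrow>\<^sub>L 'a"
    by (auto simp: op_spectrum_def scaleR_blinfun.rep_eq scaleR_scaleC[symmetric])
  have "c = r"
  proof (rule ccontr)
    assume "c \<noteq> r"
    then show False
      using *[of "(1 / (c - r)) *\<^sub>R id_blinfun"]
      by (auto simp: scaleR_blinfun.rep_eq scaleR_left_diff_distrib[symmetric]
            diff_divide_distrib[symmetric])
  qed
  then show "r \<in> {c}" by simp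
qed

lemma op_fun_scaleR_id:
  fixes x :: "'a::complex_hilbert_space"
  assumes "x \<noteq> 0"
  shows "op_fun f (c *\<^sub>R (id_blinfun :: 'a \<Rightarrow>\<^sub>L 'a)) = f c *\<^sub>R id_blinfun"
  unfolding op_fun_def
proof (rule the_equality)
  show "\<forall>p. uniform_limit {r. complex_of_real r \<in> op_spectrum (c *\<^sub>R (id_blinfun :: 'a \<Rightarrow>\<^sub>L 'a))}
          (\<lambda>n. poly (p n)) f sequentially \<longrightarrow>
        (\<lambda>n. poly_op (p n) (c *\<^sub>R (id_blinfun :: 'a \<Rightarrow>\<^sub>L 'a))) \<longlonglongrightarrow> f c *\<^sub>R id_blinfun"
    using op_spectrum_scaleR_id[OF assms]
    by (auto simp: poly_op_scaleR_id intro!: tendsto_intros dest: tendsto_uniform_limitI)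
next
  fix T :: "'a \<Rightarrow>\<^sub>L 'a"
  assume T: "\<forall>p. uniform_limit {r. complex_of_real r \<in> op_spectrum (c *\<^sub>R (id_blinfun :: 'a \<Rightarrow>\<^sub>L 'a))}
          (\<lambda>n. poly (p n)) f sequentially \<longrightarrow>
        (\<lambda>n. poly_op (p n) (c *\<^sub>R (id_blinfun :: 'a \<Rightarrow>\<^sub>L 'a))) \<longlonglongrightarrow> T"
  have "uniform_limit {r. complex_of_real r \<in> op_spectrum (c *\<^sub>R (id_blinfun :: 'a \<Rightarrow>\<^sub>L 'a))}
          (\<lambda>n::nat. poly [:f c:]) f sequentially"
    using op_spectrum_scaleR_id_subset[of c] by (intro uniform_limitI always_eventually) auto
  then have "(\<lambda>n::nat. poly_op [:f c:] (c *\<^sub>R (id_blinfun :: 'a \<Rightarrow>\<^sub>L 'a))) \<longlonglongrightarrow> T"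
    using spec[OF T, of "\<lambda>_. [:f c:]"] by simp
  then show "T = f c *\<^sub>R id_blinfun"
    by (simp add: poly_op_scaleR_id tendsto_const_iff)
qed

lemma fujii_seo_det_id:
  fixes x :: "'a::complex_hilbert_space"
  assumes "norm x = 1"
  shows "fujii_seo_det x id_blinfun = 1"
proof -
  have x: "x \<noteq> 0" using assms by auto
  have e: "Re (cinner (blinfun_apply (op_fun ln (id_blinfun + \<epsilon> *\<^sub>R id_blinfun)) x) x) = ln (1 + \<epsilon>)"
    for \<epsilon>
  proof -
    have "id_blinfun + \<epsilon> *\<^sub>R id_blinfun = (1 + \<epsilon>) *\<^sub>R (id_blinfun :: 'a \<Rightarrow>\<^sub>L 'a)"
      by (simp add: scaleR_left_distrib)
    then have "op_fun ln (id_blinfun + \<epsilon> *\<^sub>R id_blinfun) = ln (1 + \<epsilon>) *\<^sub>R (id_blinfun :: 'a \<Rightarrow>\<^sub>L 'a)"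
      using op_fun_scaleR_id[OF x] by simp
    then show ?thesis
      using assms by (simp add: scaleR_blinfun.rep_eq inner_eq_Re_cinner[symmetric] norm_eq_1)
  qed
  have "((\<lambda>\<epsilon>. ereal (ln (1 + \<epsilon>))) \<longlongrightarrow> ereal (ln (1 + 0))) (at_right 0)"
    by (intro tendsto_intros) auto
  then have "Lim (at_right 0) (\<lambda>\<epsilon>. ereal (ln (1 + \<epsilon>))) = ereal (ln (1 + 0))"
    by (intro tendsto_Lim) auto
  then show ?thesis
    by (simp add: fujii_seo_det_def e)
qed

end

theory Submission
  imports Defs "HOL-Computational_Algebra.Fundamental_Theorem_Algebra"
begin

text \<open>Write \<open>A\<close> for the operator \<open>D'D''u(z)\<close>. The elementary inequality \<open>ln t \<le> t - 1\<close>, pushed through the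
  functional calculus, gives \<open>\<langle>log (A + \<epsilon> I) x, x\<rangle> \<le> \<langle>A x, x\<rangle> + \<epsilon> - 1\<close> for a unit vector \<open>x\<close>. Letting
  \<open>\<epsilon>\<close> tend to 0, the bound \<open>1 \<le> \<Delta>\<^sub>x(A)\<close> forces \<open>\<langle>A x, x\<rangle> \<ge> 1\<close> (\<open>fujii_seo_det_ge_1D\<close>). As this
  holds for every unit vector, \<open>A \<ge> I = D'D''\<parallel>z\<parallel>\<^sup>2\<close>: on every complex line the Laplacian of
  \<open>u - \<parallel>z\<parallel>\<^sup>2\<close> is nonnegative, and the sub-mean value inequality follows.

  Nonpositivity is a maximum principle. In infinite dimension the closure of \<open>\<Omega>\<close> need not be
  compact, but its intersection with a complex line is, and this suffices (\<open>maximum_principle\<close>).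
  The maximum principle is applied to \<open>u - (1 - \<epsilon>) \<parallel>z\<parallel>\<^sup>2\<close>, for which the sub-mean value inequality
  is strict.

  Three ingredients support this. First, to speak about \<open>log (A + \<epsilon> I)\<close> and to compare such operators, one
  needs that a polynomial which is nonnegative on the spectrum of a symmetric operator gives a positive
  operator (\<open>poly_op_nonneg\<close>); this makes norm limits of polynomials in \<open>A\<close> exist and
  preserve order. Secondly, the Levi form is represented by a symmetric positive operator: it exists by
  the Riesz representation theorem, is symmetric because second derivatives are, and is
  positive because \<open>u\<close> is plurisubharmonic. Thirdly, a lower bound for the Laplacian on
  a disc is turned into a lower bound for the mean over its boundary circle
  (\<open>circle_integral_lower_bound\<close>); applied to \<open>- u\<close> on small discs it gives the positivity of the
  Levi form, and applied to \<open>u - \<kappa> \<parallel>z\<parallel>\<^sup>2\<close> it gives the conclusion.\<close>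

section \<open>Riesz representation, coercive operators and the real spectrum\<close>

lemma blinfun_ext_iff: "f = g \<longleftrightarrow> (\<forall>x. blinfun_apply f x = blinfun_apply g x)"
  by (auto intro: blinfun_eqI)

text \<open>The representing vector is the minimiser of \<open>\<parallel>x\<parallel>\<^sup>2 - 2 f x\<close>. The parallelogram identity makes
  minimising sequences Cauchy, and comparing the minimum with its values along a line gives the
  representation.\<close>
lemma Riesz_representation:
  fixes f :: "'a::{real_inner,banach} \<Rightarrow> real"
  assumes "bounded_linear f"
  obtains a where "\<And>x. f x = inner a x"
proof -
  interpret f: bounded_linear f by fact
  define J where "J x = inner x x - 2 * f x" for x
  obtain K where K: "\<And>x. norm (f x) \<le> norm x * K" and "0 < K" using f.pos_bounded by metis
  have low: "J x \<ge> - K\<^sup>2" for x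
  proof -
    have "0 \<le> (norm x - K)\<^sup>2" by simp
    then have "2 * (norm x * K) \<le> inner x x + K\<^sup>2"
      by (simp add: power2_diff power2_norm_eq_inner algebra_simps)
    then show ?thesis using K[of x] by (simp add: J_def abs_le_iff)
  qed
  then have bdd: "bdd_below (range J)" by (auto simp: bdd_below_def)
  define m where "m = Inf (range J)"
  have m: "m \<le> J x" for x unfolding m_def by (rule cInf_lower) (use bdd in auto)
  have "\<exists>x. J x < m + 1 / Suc n" for n
  proof -
    have "Inf (range J) < m + 1 / Suc n" by (simp add: m_def)
    then show ?thesis using cInf_lessD by blast
  qed
  then obtain X where X: "\<And>n. J (X n) < m + 1 / Suc n" by metis
  have par: "(norm (x - y))\<^sup>2 \<le> 2 * (J x - m) + 2 * (J y - m)" for x y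
  proof -
    have "J ((1/2) *\<^sub>R (x + y)) = J x / 2 + J y / 2 - (norm (x - y))\<^sup>2 / 4"
      by (simp add: J_def f.scaleR f.add power2_norm_eq_inner inner_left_distrib inner_right_distrib inner_diff_left
          inner_diff_right inner_commute field_simps)
    then show ?thesis using m[of "(1/2) *\<^sub>R (x + y)"] by simp
  qed
  have "Cauchy X"
  proof (rule metric_CauchyI)
    fix e :: real assume "e > 0"
    then obtain N where N: "inverse (Suc N) < e\<^sup>2 / 4"
      using reals_Archimedean[of "e\<^sup>2/4"] by auto
    have J: "J (X n) - m < e\<^sup>2 / 4" if "n \<ge> N" for n
    proof -
      have "1 / Suc n \<le> inverse (Suc N)" using that by (simp add: field_simps)
      then show ?thesis using X[of n] N by linarith
    qed
    have "dist (X i) (X j) < e" if "i \<ge> N" "j \<ge> N" for i j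
    proof -
      have "(norm (X i - X j))\<^sup>2 < e\<^sup>2" 
        using par[of "X i" "X j"] mult_strict_left_mono[OF J[OF that(1)], of 2] mult_strict_left_mono[OF J[OF that(2)], of 2] by simp
      then show ?thesis using \<open>e > 0\<close> by (simp add: dist_norm power2_less_imp_less)
    qed
    then show "\<exists>M. \<forall>i\<ge>M. \<forall>j\<ge>M. dist (X i) (X j) < e" by blast
  qed
  then obtain a where a: "X \<longlonglongrightarrow> a" using Cauchy_convergent_iff convergent_def by metis
  have "(\<lambda>n. J (X n)) \<longlonglongrightarrow> J a" unfolding J_def by (intro tendsto_intros f.tendsto a)
  moreover have "(\<lambda>n. m + 1 / Suc n) \<longlonglongrightarrow> m + 0"
    by (intro tendsto_intros LIMSEQ_Suc[OF lim_1_over_n])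
  ultimately have "J a \<le> m + 0"
    by (rule LIMSEQ_le) (use X less_imp_le in blast)
  then have min: "J a \<le> J y" for y using m[of y] by simp
  have "f x = inner a x" for x
  proof (rule ccontr)
    assume ne: "f x \<noteq> inner a x"
    define d where "d = f x - inner a x"
    have x0: "inner x x > 0" using ne by (auto simp: f.zero)
    have "J (a + t *\<^sub>R x) = J a - 2 * t * d + t\<^sup>2 * inner x x" for t
      by (simp add: J_def f.add f.scaleR d_def inner_commute power2_eq_square algebra_simps)
    \<comment> \<open>The step \<open>d / \<langle>x, x\<rangle>\<close> minimises the quadratic polynomial in \<open>t\<close>.\<close>
    then have "0 \<le> - 2 * (d / inner x x) * d + (d / inner x x)\<^sup>2 * inner x x"
      using min[of "a + (d / inner x x) *\<^sub>R x"] by simp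
    also have "\<dots> = - (d\<^sup>2 / inner x x)" using x0 by (simp add: field_simps power2_eq_square)
    finally show False using x0 ne by (simp add: d_def divide_le_0_iff)
  qed
  then show ?thesis using that by blast
qed

definition invertible_op :: "('a::real_normed_vector \<Rightarrow>\<^sub>L 'a) \<Rightarrow> bool" where
  "invertible_op T \<longleftrightarrow> (\<exists>B. B o\<^sub>L T = id_blinfun \<and> T o\<^sub>L B = id_blinfun)"

definition real_spectrum :: "('a::real_normed_vector \<Rightarrow>\<^sub>L 'a) \<Rightarrow> real set" where
  "real_spectrum T = {r. \<not> invertible_op (T - r *\<^sub>R id_blinfun)}"

definition symmetric_op :: "('a::real_inner \<Rightarrow>\<^sub>L 'a) \<Rightarrow> bool" where
  "symmetric_op T \<longleftrightarrow> (\<forall>x y. inner (blinfun_apply T x) y = inner x (blinfun_apply T y))"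

lemma symmetric_opD: "symmetric_op T \<Longrightarrow> inner (blinfun_apply T x) y = inner x (blinfun_apply T y)"
  by (simp add: symmetric_op_def)

text \<open>For real spectral parameters, scalar multiplication is the same over the reals and over the
  complex numbers, so the spectral theory below can be done in real Hilbert spaces.\<close>
lemma real_spectrum_eq:
  fixes T :: "'a::complex_hilbert_space \<Rightarrow>\<^sub>L 'a"
  shows "{r. complex_of_real r \<in> op_spectrum T} = real_spectrum T"
proof -
  have "(B o\<^sub>L (T - r *\<^sub>R id_blinfun) = id_blinfun \<and> (T - r *\<^sub>R id_blinfun) o\<^sub>L B = id_blinfun) \<longleftrightarrow>
    (\<forall>x. blinfun_apply B (blinfun_apply T x - r *\<^sub>R x) = x \<and>
            blinfun_apply T (blinfun_apply B x) - r *\<^sub>R blinfun_apply B x = x)" for B and r :: real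
    by (auto simp: blinfun_ext_iff blinfun.diff_left blinfun.scaleR_left)
  then show ?thesis
    by (simp add: real_spectrum_def invertible_op_def op_spectrum_def scaleR_scaleC[symmetric])
qed

text \<open>For small \<open>\<tau> > 0\<close> the map \<open>x \<mapsto> x - \<tau> (T x - y)\<close> is a contraction, and its fixed point solves
  \<open>T x = y\<close>; coercivity bounds the inverse.\<close>
lemma Lax_Milgram:
  fixes T :: "'a::{real_inner,banach} \<Rightarrow>\<^sub>L 'a"
  assumes c: "c > 0" and coercive: "\<And>x. c * (norm x)\<^sup>2 \<le> inner (blinfun_apply T x) x"
  shows "invertible_op T"
proof -
  define M where "M = norm T + c"
  have M: "M > 0" "c \<le> M" using c by (auto simp: M_def intro: add_nonneg_pos)
  \<comment> \<open>This \<open>\<tau>\<close> minimises \<open>1 - 2 \<tau> c + \<tau>\<^sup>2 M\<^sup>2\<close>, and \<open>q\<close> is the minimum.\<close>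
  define \<tau> where "\<tau> = c / M\<^sup>2"
  define q where "q = 1 - c\<^sup>2 / M\<^sup>2"
  have "c\<^sup>2 \<le> M\<^sup>2" using M c by (intro power_mono) auto
  then have q: "0 \<le> q" "q < 1" using M c by (auto simp: q_def field_simps)
  have contr: "(norm (x - \<tau> *\<^sub>R blinfun_apply T x))\<^sup>2 \<le> q * (norm x)\<^sup>2" for x
  proof -
    have "norm (blinfun_apply T x) \<le> M * norm x"
      using norm_blinfun[of T x] c by (simp add: M_def distrib_right add_increasing2)
    then have "(norm (blinfun_apply T x))\<^sup>2 \<le> M\<^sup>2 * (norm x)\<^sup>2"
      using M by (metis norm_ge_zero power_mono power_mult_distrib)
    then have 1: "\<tau>\<^sup>2 * (norm (blinfun_apply T x))\<^sup>2 \<le> \<tau>\<^sup>2 * (M\<^sup>2 * (norm x)\<^sup>2)"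
      by (intro mult_left_mono) auto
    have 2: "2 * \<tau> * inner (blinfun_apply T x) x \<ge> 2 * \<tau> * (c * (norm x)\<^sup>2)"
      using coercive[of x] c M by (intro mult_left_mono) (auto simp: \<tau>_def)
    have "(norm (x - \<tau> *\<^sub>R blinfun_apply T x))\<^sup>2 =
       (norm x)\<^sup>2 - 2 * \<tau> * inner (blinfun_apply T x) x + \<tau>\<^sup>2 * (norm (blinfun_apply T x))\<^sup>2"
      unfolding power2_norm_eq_inner by (simp add: inner_commute power2_eq_square algebra_simps)
    also have "\<dots> \<le> (norm x)\<^sup>2 - 2 * \<tau> * (c * (norm x)\<^sup>2) + \<tau>\<^sup>2 * (M\<^sup>2 * (norm x)\<^sup>2)"
      using 1 2 by linarith
    also have "\<dots> = q * (norm x)\<^sup>2"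
      using M by (simp add: \<tau>_def q_def field_simps power2_eq_square)
    finally show ?thesis .
  qed
  have contr': "norm (x - \<tau> *\<^sub>R blinfun_apply T x) \<le> sqrt q * norm x" for x
    using contr[of x] q by (metis abs_norm_cancel real_sqrt_abs real_sqrt_le_mono real_sqrt_mult)
  have tau: "\<tau> \<noteq> 0" using c M by (simp add: \<tau>_def)
  have ex: "\<exists>!x. blinfun_apply T x = y" for y
  proof -
    have "\<exists>!x. x - \<tau> *\<^sub>R (blinfun_apply T x - y) = x"
    proof (rule banach_fix_type[of "sqrt q"])
      show "\<forall>x x'. dist (x - \<tau> *\<^sub>R (blinfun_apply T x - y)) (x' - \<tau> *\<^sub>R (blinfun_apply T x' - y)) \<le> sqrt q * dist x x'"
      proof (intro allI)
        fix x x'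
        show "dist (x - \<tau> *\<^sub>R (blinfun_apply T x - y)) (x' - \<tau> *\<^sub>R (blinfun_apply T x' - y)) \<le> sqrt q * dist x x'"
          using contr'[of "x - x'"] by (simp add: dist_norm blinfun.diff_right algebra_simps)
      qed
    qed (use q in auto)
    then show ?thesis using tau by simp
  qed
  define B where "B y = (THE x. blinfun_apply T x = y)" for y
  have TB: "blinfun_apply T (B y) = y" for y unfolding B_def by (rule theI'[OF ex])
  have BT: "B (blinfun_apply T x) = x" for x using ex TB by metis
  have bl: "bounded_linear B"
  proof (rule bounded_linear_intro)
    show "B (x + y) = B x + B y" for x y by (metis TB BT blinfun.add_right)
    show "B (r *\<^sub>R x) = r *\<^sub>R B x" for r x by (metis TB BT blinfun.scaleR_right)
    show "norm (B x) \<le> norm x * (1 / c)" for x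
    proof -
      have "c * (norm (B x))\<^sup>2 \<le> norm x * norm (B x)"
        using coercive[of "B x"] Cauchy_Schwarz_ineq2[of x "B x"] by (simp add: TB)
      then have "c * norm (B x) \<le> norm x"
        by (cases "B x = 0") (auto simp: power2_eq_square)
      then show ?thesis using c by (simp add: field_simps)
    qed
  qed
  show ?thesis unfolding invertible_op_def
    by (rule exI[of _ "Blinfun B"]) (auto intro!: blinfun_eqI simp: bounded_linear_Blinfun_apply[OF bl] TB BT)
qed

lemma real_spectrum_bounds:
  fixes T :: "'a::{real_inner,banach} \<Rightarrow>\<^sub>L 'a"
  assumes "\<And>x. m * (norm x)\<^sup>2 \<le> inner (blinfun_apply T x) x"
  shows "real_spectrum T \<subseteq> {m..norm T}"
proof
  fix r assume r: "r \<in> real_spectrum T"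
  have "\<not> r < m"
  proof
    assume "r < m"
    then have "invertible_op (T - r *\<^sub>R id_blinfun)"
      using assms by (intro Lax_Milgram[of "m - r"])
        (auto simp: blinfun.diff_left blinfun.scaleR_left inner_diff_left power2_norm_eq_inner[symmetric] left_diff_distrib)
    then show False using r by (simp add: real_spectrum_def)
  qed
  moreover have "\<not> r > norm T"
  proof
    assume "r > norm T"
    then have "invertible_op (r *\<^sub>R id_blinfun - T)"
    proof (intro Lax_Milgram[of "r - norm T"])
      fix x
      have "inner (blinfun_apply T x) x \<le> norm T * norm x * norm x"
        using norm_cauchy_schwarz[of "blinfun_apply T x" x] mult_right_mono[OF norm_blinfun[of T x], of "norm x"]
        by simp
      then show "(r - norm T) * (norm x)\<^sup>2 \<le> inner (blinfun_apply (r *\<^sub>R id_blinfun - T) x) x"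
        by (simp add: blinfun.diff_left blinfun.scaleR_left inner_diff_left power2_norm_eq_inner[symmetric]
            left_diff_distrib power2_eq_square mult.assoc)
    qed auto
    then obtain B where B: "B o\<^sub>L (r *\<^sub>R id_blinfun - T) = id_blinfun" "(r *\<^sub>R id_blinfun - T) o\<^sub>L B = id_blinfun"
      by (auto simp: invertible_op_def)
    have "(- B) o\<^sub>L (T - r *\<^sub>R id_blinfun) = id_blinfun" "(T - r *\<^sub>R id_blinfun) o\<^sub>L (- B) = id_blinfun"
      using B by (auto simp: blinfun_ext_iff blinfun.diff_left blinfun.minus_left blinfun.minus_right
          blinfun.scaleR_left blinfun.diff_right blinfun.scaleR_right)
    then have "invertible_op (T - r *\<^sub>R id_blinfun)" by (auto simp: invertible_op_def)
    then show False using r by (simp add: real_spectrum_def)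
  qed
  ultimately show "r \<in> {m..norm T}" by auto
qed

section \<open>Polynomials in a symmetric operator\<close>

text \<open>The upper summation limit may exceed the degree, which makes inductions over polynomials possible.\<close>
lemma poly_op_altdef:
  assumes "degree p \<le> n"
  shows "poly_op p A = (\<Sum>i\<le>n. coeff p i *\<^sub>R (((o\<^sub>L) A ^^ i) id_blinfun))"
  unfolding poly_op_def
  by (rule sum.mono_neutral_left) (use assms in \<open>auto simp: coeff_eq_0\<close>)

lemma poly_op_0 [simp]: "poly_op 0 A = 0"
  by (simp add: poly_op_def)

lemma poly_op_pCons [simp]: "poly_op (pCons a p) A = a *\<^sub>R id_blinfun + (A o\<^sub>L poly_op p A)"
proof -
  have "poly_op (pCons a p) A = (\<Sum>i\<le>Suc (degree p). coeff (pCons a p) i *\<^sub>R (((o\<^sub>L) A ^^ i) id_blinfun))"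
    by (rule poly_op_altdef) (simp add: degree_pCons_le)
  also have "\<dots> = a *\<^sub>R id_blinfun + (\<Sum>i\<le>degree p. coeff p i *\<^sub>R (A o\<^sub>L (((o\<^sub>L) A ^^ i) id_blinfun)))"
    by (subst sum.atMost_Suc_shift) simp
  also have "(\<Sum>i\<le>degree p. coeff p i *\<^sub>R (A o\<^sub>L (((o\<^sub>L) A ^^ i) id_blinfun))) = A o\<^sub>L poly_op p A"
    by (auto intro!: blinfun_eqI simp: poly_op_def blinfun.sum_left blinfun.sum_right blinfun.scaleR_left blinfun.scaleR_right)
  finally show ?thesis .
qed

lemma poly_op_add: "poly_op (p + q) A = poly_op p A + poly_op q A"
  by (induction p q rule: poly_induct2)
    (auto simp: blinfun_ext_iff blinfun.add_left blinfun.add_right blinfun.scaleR_left scaleR_left_distrib)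

lemma poly_op_smult: "poly_op (smult c p) A = c *\<^sub>R poly_op p A"
  by (induction p) (auto simp: blinfun_ext_iff blinfun.add_left blinfun.scaleR_left blinfun.scaleR_right scaleR_right_distrib)

lemma poly_op_diff: "poly_op (p - q) A = poly_op p A - poly_op q A"
  using poly_op_add[of p "smult (-1) q" A] unfolding poly_op_smult by simp

lemma poly_op_mult: "poly_op (p * q) A = poly_op p A o\<^sub>L poly_op q A"
  by (induction p) (auto simp: blinfun_ext_iff poly_op_add poly_op_smult blinfun.add_left blinfun.scaleR_left)

lemma poly_op_pcompose_shift:
  "poly_op (pcompose p [:e, 1:]) A = poly_op p (A + e *\<^sub>R id_blinfun)"
proof (induction p)
  case (pCons a p)
  have "pcompose (pCons a p) [:e, 1:] = [:a:] + [:e, 1:] * pcompose p [:e, 1:]"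
    by (rule pcompose_pCons)
  then show ?case
    unfolding \<open>pcompose (pCons a p) [:e, 1:] = _\<close> poly_op_add poly_op_mult pCons.IH
    by (auto simp: blinfun_ext_iff blinfun.add_left blinfun.scaleR_left)
qed simp

lemma symmetric_op_poly_op:
  assumes "symmetric_op T"
  shows "symmetric_op (poly_op p T)"
proof -
  have comm: "T o\<^sub>L poly_op p T = poly_op p T o\<^sub>L T" for p
  proof -
    have "poly_op [:0,1:] T = T"
      by (simp add: blinfun_ext_iff blinfun.add_left blinfun.scaleR_left blinfun.add_right)
    then show ?thesis by (metis poly_op_mult mult.commute)
  qed
  show ?thesis
  proof (induction p)
    case (pCons a p)
    show ?case unfolding symmetric_op_def
    proof (intro allI)
      fix x y
      have "inner (blinfun_apply T (blinfun_apply (poly_op p T) x)) y = inner x (blinfun_apply (poly_op p T) (blinfun_apply T y))"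
        using symmetric_opD[OF assms] symmetric_opD[OF pCons.IH] by simp
      also have "blinfun_apply (poly_op p T) (blinfun_apply T y) = blinfun_apply T (blinfun_apply (poly_op p T) y)"
        using comm[of p] by (simp add: blinfun_ext_iff)
      finally show "inner (blinfun_apply (poly_op (pCons a p) T) x) y = inner x (blinfun_apply (poly_op (pCons a p) T) y)"
        by (simp add: blinfun.add_left blinfun.scaleR_left inner_add_left inner_add_right)
    qed
  qed (simp add: symmetric_op_def)
qed

lemma invertible_op_compose:
  assumes "invertible_op S" "invertible_op T"
  shows "invertible_op (S o\<^sub>L T)"
proof -
  obtain B C where "B o\<^sub>L S = id_blinfun" "S o\<^sub>L B = id_blinfun" "C o\<^sub>L T = id_blinfun" "T o\<^sub>L C = id_blinfun"
    using assms by (auto simp: invertible_op_def)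
  then have "(C o\<^sub>L B) o\<^sub>L (S o\<^sub>L T) = id_blinfun" "(S o\<^sub>L T) o\<^sub>L (C o\<^sub>L B) = id_blinfun"
    by (auto simp: blinfun_ext_iff)
  then show ?thesis unfolding invertible_op_def by blast
qed

text \<open>A complex root \<open>a + i b\<close> with \<open>b \<noteq> 0\<close> exists, and the factor is \<open>(x - a)\<^sup>2 + b\<^sup>2\<close>: the remainder
  of the division by it is at most linear, has real coefficients and vanishes at \<open>a + i b\<close>, hence is zero.\<close>
lemma real_poly_quadratic_factor:
  fixes p :: "real poly"
  assumes "degree p > 0" "\<And>r. poly p r \<noteq> 0"
  obtains a b where "b \<noteq> 0" "[:a\<^sup>2 + b\<^sup>2, - 2 * a, 1:] dvd p"
proof -
  let ?P = "map_poly complex_of_real"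
  have "degree (?P p) > 0" using assms(1) by (simp add: degree_map_poly)
  then obtain c where c: "poly (?P p) c = 0" using alg_closed_imp_poly_has_root by blast
  define a b where "a = Re c" and "b = Im c"
  have b: "b \<noteq> 0"
  proof
    assume "b = 0"
    then have "c = complex_of_real a" by (simp add: a_def b_def complex_eq_iff)
    moreover have "poly (?P p) (complex_of_real a) = complex_of_real (poly p a)"
      by (induction p) (auto simp: map_poly_pCons)
    ultimately show False using assms(2) c by simp
  qed
  define q where "q = [:a\<^sup>2 + b\<^sup>2, - 2 * a, 1:]"
  have q0: "poly (?P q) c = 0"
    by (simp add: q_def map_poly_pCons complex_eq_iff a_def b_def power2_eq_square algebra_simps)
  define r where "r = p mod q"
  have add: "poly (?P (f + g)) c = poly (?P f) c + poly (?P g) c" for f g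
    by (induction f g rule: poly_induct2) (auto simp: map_poly_pCons algebra_simps)
  have smult: "poly (?P (smult d g)) c = of_real d * poly (?P g) c" for d g
    by (induction g) (auto simp: map_poly_pCons algebra_simps)
  have mult: "poly (?P (f * g)) c = poly (?P f) c * poly (?P g) c" for f g
    by (induction f) (auto simp: map_poly_pCons add smult algebra_simps)
  have "poly (?P p) c = poly (?P (p div q * q + r)) c" by (simp add: r_def)
  also have "\<dots> = poly (?P (p div q)) c * poly (?P q) c + poly (?P r) c" by (simp only: add mult)
  finally have r0: "poly (?P r) c = 0" using c q0 by simp
  have "q \<noteq> 0" "degree q = 2" by (auto simp: q_def)
  then have deg: "r = 0 \<or> degree r < 2" using degree_mod_less[of q p] by (simp add: r_def)
  obtain r0 s where s: "r = pCons r0 s" by (rule pCons_cases)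
  have "degree s = 0" using deg by (cases "s = 0") (auto simp: s)
  then obtain r1 where r: "r = [:r0, r1:]" using s by (metis degree_eq_zeroE)
  have "r1 * b = 0" "r0 + r1 * a = 0"
    using r0 by (auto simp: r map_poly_pCons complex_eq_iff a_def b_def algebra_simps)
  then have "r = 0" using b by (simp add: r)
  then have "q dvd p" by (simp add: r_def mod_eq_0_iff_dvd)
  then show ?thesis using that b q_def by blast
qed

text \<open>The nontrivial half of the spectral mapping theorem, by factorisation over the reals. Linear
  factors are invertible because their roots are off the spectrum, and a quadratic factor
  \<open>(T - a)\<^sup>2 + b\<^sup>2 \<ge> b\<^sup>2\<close> is coercive because \<open>T - a\<close> is symmetric.\<close>
lemma invertible_poly_op:
  fixes T :: "'a::{real_inner,banach} \<Rightarrow>\<^sub>L 'a"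
  assumes sym: "symmetric_op T" and "p \<noteq> 0" "\<And>r. r \<in> real_spectrum T \<Longrightarrow> poly p r \<noteq> 0"
  shows "invertible_op (poly_op p T)"
  using assms(2,3)
proof (induction "degree p" arbitrary: p rule: less_induct)
  case (less p)
  have factor: "invertible_op (poly_op p T)" if "q dvd p" "degree q > 0" "invertible_op (poly_op q T)" for q
  proof -
    obtain s where s: "p = q * s" using \<open>q dvd p\<close> by auto
    have "q \<noteq> 0" "s \<noteq> 0" using less.prems s by auto
    then have "degree s < degree p" using s that(2) by (simp add: degree_mult_eq)
    moreover have "poly s r \<noteq> 0" if "r \<in> real_spectrum T" for r using less.prems(2)[OF that] s by auto
    ultimately have "invertible_op (poly_op s T)" using less.hyps \<open>s \<noteq> 0\<close> by blast
    then show ?thesis using invertible_op_compose that(3) by (simp add: s poly_op_mult)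
  qed
  consider "degree p = 0" | r where "poly p r = 0" | "degree p > 0" "\<And>r. poly p r \<noteq> 0" by blast
  then show ?case
  proof cases
    case 1
    then obtain c where c: "p = [:c:]" by (metis degree_eq_zeroE)
    then have "c \<noteq> 0" using less.prems by auto
    then show ?thesis
      by (auto simp: c invertible_op_def blinfun_ext_iff blinfun.scaleR_left blinfun.add_left blinfun.scaleR_right
          intro!: exI[of _ "(1/c) *\<^sub>R id_blinfun"])
  next
    case (2 r)
    then have "r \<notin> real_spectrum T" using less.prems by blast
    moreover have "poly_op [:- r, 1:] T = T - r *\<^sub>R id_blinfun"
      by (simp add: blinfun_ext_iff blinfun.add_left blinfun.scaleR_left blinfun.diff_left blinfun.add_right blinfun.minus_left)
    ultimately show ?thesis
      using factor[of "[:- r, 1:]"] 2 by (simp add: poly_eq_0_iff_dvd real_spectrum_def)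
  next
    case 3
    then obtain a b where ab: "b \<noteq> 0" "[:a\<^sup>2 + b\<^sup>2, - 2 * a, 1:] dvd p"
      using real_poly_quadratic_factor by blast
    have "invertible_op (poly_op [:a\<^sup>2 + b\<^sup>2, - 2 * a, 1:] T)"
    proof (rule Lax_Milgram)
      show "0 < b\<^sup>2" using ab by simp
      fix x
      have "inner (blinfun_apply (poly_op [:a\<^sup>2 + b\<^sup>2, - 2 * a, 1:] T) x) x = 
        b\<^sup>2 * (norm x)\<^sup>2 + (norm (blinfun_apply T x - a *\<^sub>R x))\<^sup>2"
        using symmetric_opD[OF sym, of "blinfun_apply T x" x]
        unfolding power2_norm_eq_inner
        by (simp add: blinfun.add_left blinfun.diff_left blinfun.scaleR_left blinfun.add_right blinfun.diff_right
            blinfun.scaleR_right inner_commute algebra_simps power2_eq_square)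
      then show "b\<^sup>2 * (norm x)\<^sup>2 \<le> inner (blinfun_apply (poly_op [:a\<^sup>2 + b\<^sup>2, - 2 * a, 1:] T) x) x" by simp
    qed
    then show ?thesis using factor[OF ab(2)] by simp
  qed
qed

text \<open>For a positive operator, \<open>\<parallel>C x\<parallel>\<^sup>2\<close> is at most a constant times \<open>\<langle>C x, x\<rangle>\<close>, so a vector on which the
  quadratic form is small is almost in the kernel; invertibility excludes this.\<close>
lemma invertible_nonneg_coercive:
  fixes C :: "'a::real_inner \<Rightarrow>\<^sub>L 'a"
  assumes sym: "symmetric_op C" and nonneg: "\<And>x. 0 \<le> inner (blinfun_apply C x) x"
    and inv: "invertible_op C"
  obtains k where "k > 0" "\<And>x. k * (norm x)\<^sup>2 \<le> inner (blinfun_apply C x) x"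
proof -
  obtain B where B: "B o\<^sub>L C = id_blinfun" using inv by (auto simp: invertible_op_def)
  \<comment> \<open>Adding 1 only serves to make both constants positive.\<close>
  define N where "N = norm C + 1"
  define M where "M = norm B + 1"
  have N: "N > 0" and M: "M > 0" by (auto simp: N_def M_def add_nonneg_pos)
  have CC: "(norm (blinfun_apply C x))\<^sup>2 \<le> N * inner (blinfun_apply C x) x" for x
  proof -
    define y where "y = blinfun_apply C x"
    \<comment> \<open>Positivity of the form at \<open>x - C x / N\<close> gives the estimate.\<close>
    define w where "w = x - (1/N) *\<^sub>R y"
    have Cy: "inner (blinfun_apply C y) y \<le> N * (norm y)\<^sup>2"
    proof -
      have "inner (blinfun_apply C y) y \<le> norm C * norm y * norm y"
        using norm_cauchy_schwarz[of "blinfun_apply C y" y] mult_right_mono[OF norm_blinfun[of C y], of "norm y"]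
        by simp
      also have "\<dots> \<le> N * (norm y)\<^sup>2"
        by (simp add: N_def power2_eq_square algebra_simps)
      finally show ?thesis .
    qed
    have "0 \<le> inner (blinfun_apply C w) w" by (rule nonneg)
    also have "\<dots> = inner y x - (2/N) * (norm y)\<^sup>2 + (1/N)\<^sup>2 * inner (blinfun_apply C y) y"
      using symmetric_opD[OF sym, of y x]
      unfolding power2_norm_eq_inner
      by (simp add: w_def blinfun.diff_right blinfun.scaleR_right inner_diff_left inner_diff_right y_def[symmetric]
          power2_eq_square algebra_simps inner_commute)
    also have "\<dots> \<le> inner y x - (2/N) * (norm y)\<^sup>2 + (1/N)\<^sup>2 * (N * (norm y)\<^sup>2)"
      using Cy by (intro add_left_mono mult_left_mono) auto
    also have "\<dots> = inner y x - (norm y)\<^sup>2 / N" using N by (simp add: field_simps power2_eq_square)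
    finally show ?thesis using N by (simp add: y_def field_simps)
  qed
  show ?thesis
  proof
    show "1 / (N * M\<^sup>2) > 0" using N M by simp
    fix x
    have "blinfun_apply B (blinfun_apply C x) = x" using B by (simp add: blinfun_ext_iff)
    then have "norm x \<le> M * norm (blinfun_apply C x)"
      using norm_blinfun[of B "blinfun_apply C x"] by (simp add: M_def distrib_right add_increasing2)
    then have "(norm x)\<^sup>2 \<le> M\<^sup>2 * (norm (blinfun_apply C x))\<^sup>2"
      by (metis norm_ge_zero power_mono power_mult_distrib)
    also have "\<dots> \<le> M\<^sup>2 * (N * inner (blinfun_apply C x) x)"
      using CC by (intro mult_left_mono) auto
    finally show "1 / (N * M\<^sup>2) * (norm x)\<^sup>2 \<le> inner (blinfun_apply C x) x"
      using N M by (simp add: field_simps)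
  qed
qed

text \<open>The infimum \<open>m\<close> of the quadratic form on the unit sphere lies in the spectrum, since otherwise
  \<open>P - m\<close> would be invertible and positive, hence coercive, and the infimum could be raised.\<close>
lemma numerical_minimum_in_spectrum:
  fixes P :: "'a::real_inner \<Rightarrow>\<^sub>L 'a"
  assumes sym: "symmetric_op P" and x0: "(x0::'a) \<noteq> 0"
  obtains m where "m \<in> real_spectrum P" "\<And>y. m * (norm y)\<^sup>2 \<le> inner (blinfun_apply P y) y"
proof -
  define Q where "Q = (\<lambda>y. inner (blinfun_apply P y) y) ` sphere 0 1"
  define m where "m = Inf Q"
  have bdd: "bdd_below Q"
    unfolding bdd_below_def
  proof (intro exI ballI)
    fix r assume "r \<in> Q"
    then obtain y where y: "norm y = 1" "r = inner (blinfun_apply P y) y" by (auto simp: Q_def)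
    then show "- norm P \<le> r"
      using Cauchy_Schwarz_ineq2[of "blinfun_apply P y" y] norm_blinfun[of P y] by auto
  qed
  have scale: "inner (blinfun_apply P ((1 / norm y) *\<^sub>R y)) ((1 / norm y) *\<^sub>R y) = inner (blinfun_apply P y) y / (norm y)\<^sup>2" for y
    by (simp add: blinfun.scaleR_right power2_eq_square)
  have inQ: "inner (blinfun_apply P y) y / (norm y)\<^sup>2 \<in> Q" if "y \<noteq> 0" for y
    unfolding Q_def scale[symmetric] by (rule imageI) (use that in simp)
  have low: "m * (norm y)\<^sup>2 \<le> inner (blinfun_apply P y) y" for y
    using cInf_lower[OF inQ[of y] bdd] by (cases "y = 0") (auto simp: m_def field_simps)
  have "\<not> invertible_op (P - m *\<^sub>R id_blinfun)"
  proof
    assume "invertible_op (P - m *\<^sub>R id_blinfun)"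
    moreover have "symmetric_op (P - m *\<^sub>R id_blinfun)"
      using sym by (simp add: symmetric_op_def blinfun.diff_left blinfun.scaleR_left inner_diff_left inner_diff_right)
    moreover have "0 \<le> inner (blinfun_apply (P - m *\<^sub>R id_blinfun) y) y" for y
      using low[of y] by (simp add: blinfun.diff_left blinfun.scaleR_left inner_diff_left power2_norm_eq_inner)
    ultimately obtain k where k: "k > 0" "\<And>y. k * (norm y)\<^sup>2 \<le> inner (blinfun_apply (P - m *\<^sub>R id_blinfun) y) y"
      using invertible_nonneg_coercive by blast
    have "m + k \<le> Inf Q"
    proof (rule cInf_greatest)
      show "Q \<noteq> {}" using inQ x0 by blast
      fix r assume "r \<in> Q"
      then obtain y where "norm y = 1" "r = inner (blinfun_apply P y) y" by (auto simp: Q_def)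
      moreover from this have "inner y y = 1" by (simp add: norm_eq_1)
      ultimately show "m + k \<le> r"
        using k(2)[of y] by (simp add: blinfun.diff_left blinfun.scaleR_left inner_diff_left)
    qed
    then show False using k by (simp add: m_def)
  qed
  then show ?thesis using that low by (auto simp: real_spectrum_def)
qed

text \<open>The smallest value \<open>m\<close> of the quadratic form of \<open>p(T)\<close> lies in the spectrum of \<open>p(T)\<close>. If it were
  negative, \<open>p - m\<close> would be positive on the spectrum of \<open>T\<close>, hence \<open>p(T) - m\<close> invertible.\<close>
lemma poly_op_nonneg:
  fixes T :: "'a::{real_inner,banach} \<Rightarrow>\<^sub>L 'a"
  assumes sym: "symmetric_op T" and pos: "\<And>r. r \<in> real_spectrum T \<Longrightarrow> 0 \<le> poly p r"
  shows "0 \<le> inner (blinfun_apply (poly_op p T) x) x"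
proof (cases "x = 0")
  case False
  obtain m where m: "m \<in> real_spectrum (poly_op p T)"
    "\<And>y. m * (norm y)\<^sup>2 \<le> inner (blinfun_apply (poly_op p T) y) y"
    using numerical_minimum_in_spectrum[OF symmetric_op_poly_op[OF sym] False] by blast
  obtain r where r: "r \<in> real_spectrum T"
    using numerical_minimum_in_spectrum[OF sym False] by blast
  have "0 \<le> m"
  proof (rule ccontr)
    assume "\<not> 0 \<le> m"
    then have nz: "poly (p - [:m:]) r \<noteq> 0" if "r \<in> real_spectrum T" for r using pos[OF that] by auto
    have "invertible_op (poly_op (p - [:m:]) T)"
      by (rule invertible_poly_op[OF sym _ nz]) (use nz[OF r] in auto)
    moreover have "poly_op (p - [:m:]) T = poly_op p T - m *\<^sub>R id_blinfun"
      by (simp add: poly_op_diff blinfun_ext_iff blinfun.diff_left blinfun.add_left blinfun.scaleR_left)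
    ultimately show False using m(1) by (simp add: real_spectrum_def)
  qed
  then show ?thesis using m(2)[of x] by (meson mult_nonneg_nonneg order_trans zero_le_power2)
qed simp

section \<open>The functional calculus and the Fujii--Seo determinant\<close>

text \<open>The polynomial \<open>c\<^sup>2 - p\<^sup>2\<close> is nonnegative on the spectrum, so \<open>\<parallel>p(T) x\<parallel>\<^sup>2 \<le> c\<^sup>2 \<parallel>x\<parallel>\<^sup>2\<close>.\<close>
lemma norm_poly_op_le:
  fixes T :: "'a::{real_inner,banach} \<Rightarrow>\<^sub>L 'a"
  assumes sym: "symmetric_op T" and c: "0 \<le> c" "\<And>r. r \<in> real_spectrum T \<Longrightarrow> \<bar>poly p r\<bar> \<le> c"
  shows "norm (poly_op p T) \<le> c"
proof (rule norm_blinfun_bound[OF c(1)])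
  fix x
  have "0 \<le> inner (blinfun_apply (poly_op ([:c\<^sup>2:] - p * p) T) x) x"
  proof (rule poly_op_nonneg[OF sym])
    fix r assume "r \<in> real_spectrum T"
    then have "(poly p r)\<^sup>2 \<le> c\<^sup>2" using c abs_le_square_iff[of "poly p r" c] by simp
    then show "0 \<le> poly ([:c\<^sup>2:] - p * p) r" by (simp add: power2_eq_square)
  qed
  also have "\<dots> = c\<^sup>2 * (norm x)\<^sup>2 - (norm (blinfun_apply (poly_op p T) x))\<^sup>2"
    unfolding power2_norm_eq_inner
    using symmetric_opD[OF symmetric_op_poly_op[OF sym], of p "blinfun_apply (poly_op p T) x" x]
    by (simp add: poly_op_diff poly_op_mult blinfun.diff_left blinfun.scaleR_left blinfun.add_left inner_diff_left)
  finally have "(norm (blinfun_apply (poly_op p T) x))\<^sup>2 \<le> (c * norm x)\<^sup>2"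
    by (simp add: power_mult_distrib)
  then show "norm (blinfun_apply (poly_op p T) x) \<le> c * norm x"
    by (rule power2_le_imp_le) (use c(1) in simp)
qed

lemma poly_op_uniformly_close:
  fixes T :: "'a::{real_inner,banach} \<Rightarrow>\<^sub>L 'a"
  assumes sym: "symmetric_op T"
    and p: "uniform_limit (real_spectrum T) (\<lambda>n. poly (p n)) f sequentially"
    and q: "uniform_limit (real_spectrum T) (\<lambda>n. poly (q n)) f sequentially"
    and e: "e > 0"
  shows "\<exists>N. \<forall>m\<ge>N. \<forall>n\<ge>N. norm (poly_op (p m) T - poly_op (q n) T) \<le> e"
proof -
  obtain N1 where N1: "\<And>n r. n \<ge> N1 \<Longrightarrow> r \<in> real_spectrum T \<Longrightarrow> dist (poly (p n) r) (f r) < e/2"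
    using uniform_limitD[OF p, of "e/2"] e by (auto simp: eventually_sequentially)
  obtain N2 where N2: "\<And>n r. n \<ge> N2 \<Longrightarrow> r \<in> real_spectrum T \<Longrightarrow> dist (poly (q n) r) (f r) < e/2"
    using uniform_limitD[OF q, of "e/2"] e by (auto simp: eventually_sequentially)
  have "norm (poly_op (p m) T - poly_op (q n) T) \<le> e" if "m \<ge> max N1 N2" "n \<ge> max N1 N2" for m n
    unfolding poly_op_diff[symmetric]
  proof (rule norm_poly_op_le[OF sym])
    fix r assume r: "r \<in> real_spectrum T"
    have "dist (poly (p m) r) (f r) < e/2" "dist (poly (q n) r) (f r) < e/2"
      using N1[OF _ r] N2[OF _ r] that by auto
    then show "\<bar>poly (p m - q n) r\<bar> \<le> e"
      unfolding dist_real_def poly_diff by linarith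
  qed (use e in simp)
  then show ?thesis by blast
qed

text \<open>As soon as one sequence of polynomials approximates \<open>f\<close> on the spectrum, the definite description
  in the functional calculus denotes: all such sequences give the same norm limit.\<close>
lemma op_fun_tendsto:
  fixes T :: "'a::complex_hilbert_space \<Rightarrow>\<^sub>L 'a"
  assumes sym: "symmetric_op T"
    and q: "uniform_limit (real_spectrum T) (\<lambda>n. poly (q n)) f sequentially"
  shows "(\<lambda>n. poly_op (q n) T) \<longlonglongrightarrow> op_fun f T"
proof -
  have "Cauchy (\<lambda>n. poly_op (q n) T)"
  proof (rule metric_CauchyI)
    fix e :: real assume "e > 0"
    then obtain N where N: "\<forall>m\<ge>N. \<forall>n\<ge>N. norm (poly_op (q m) T - poly_op (q n) T) \<le> e/2"
      using poly_op_uniformly_close[OF sym q q, of "e/2"] by auto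
    show "\<exists>M. \<forall>m\<ge>M. \<forall>n\<ge>M. dist (poly_op (q m) T) (poly_op (q n) T) < e"
      using N \<open>e > 0\<close> by (intro exI[of _ N]) (force simp: dist_norm)
  qed
  then obtain L where L: "(\<lambda>n. poly_op (q n) T) \<longlonglongrightarrow> L"
    using Cauchy_convergent_iff convergent_def by metis
  have lim: "(\<lambda>n. poly_op (p n) T) \<longlonglongrightarrow> L"
    if p: "uniform_limit (real_spectrum T) (\<lambda>n. poly (p n)) f sequentially" for p
  proof -
    have "(\<lambda>n. poly_op (p n) T - poly_op (q n) T) \<longlonglongrightarrow> 0"
    proof (rule LIMSEQ_I)
      fix e :: real assume "e > 0"
      then obtain N where N: "\<forall>m\<ge>N. \<forall>n\<ge>N. norm (poly_op (p m) T - poly_op (q n) T) \<le> e/2"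
        using poly_op_uniformly_close[OF sym p q, of "e/2"] by auto
      show "\<exists>M. \<forall>n\<ge>M. norm (poly_op (p n) T - poly_op (q n) T - 0) < e"
        using N \<open>e > 0\<close> by (intro exI[of _ N]) force
    qed
    from tendsto_add[OF this L] show ?thesis by simp
  qed
  have "op_fun f T = L"
    unfolding op_fun_def real_spectrum_eq
  proof (rule the_equality)
    fix T' assume "\<forall>p. uniform_limit (real_spectrum T) (\<lambda>n. poly (p n)) f sequentially \<longrightarrow>
        (\<lambda>n. poly_op (p n) T) \<longlonglongrightarrow> T'"
    then have "(\<lambda>n. poly_op (q n) T) \<longlonglongrightarrow> T'" using q by blast
    then show "T' = L" using L LIMSEQ_unique by blast
  qed (use lim in blast)
  then show ?thesis using L by simp
qed

lemma Weierstrass_poly: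
  fixes f :: "real \<Rightarrow> real"
  assumes "continuous_on {a..b} f"
  obtains p where "uniform_limit {a..b} (\<lambda>n. poly (p n)) f sequentially"
proof -
  have "\<exists>p. \<forall>x\<in>{a..b}. \<bar>f x - poly p x\<bar> < 1 / Suc n" for n
  proof -
    obtain g where g: "real_polynomial_function g" "\<And>x. x \<in> {a..b} \<Longrightarrow> \<bar>f x - g x\<bar> < 1 / Suc n"
      using Stone_Weierstrass_real_polynomial_function[of "{a..b}" f "1 / Suc n"] assms by auto
    then obtain c k where c: "g = (\<lambda>x. \<Sum>i\<le>k. c i * x ^ i)"
      by (auto simp: real_polynomial_function_iff_sum)
    have "poly (\<Sum>i\<le>k. monom (c i) i) x = g x" for x
      by (simp add: c poly_sum poly_monom)
    then show ?thesis using g(2) by metis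
  qed
  then obtain p where p: "\<And>n x. x \<in> {a..b} \<Longrightarrow> \<bar>f x - poly (p n) x\<bar> < 1 / Suc n" by metis
  have "uniform_limit {a..b} (\<lambda>n. poly (p n)) f sequentially"
  proof (rule uniform_limitI)
    fix e :: real assume "e > 0"
    then obtain N where N: "inverse (Suc N) < e" using reals_Archimedean by blast
    show "\<forall>\<^sub>F n in sequentially. \<forall>x\<in>{a..b}. dist (poly (p n) x) (f x) < e"
    proof (rule eventually_sequentiallyI[of N], intro ballI)
      fix n x assume "n \<ge> N" "x \<in> {a..b}"
      have "1 / Suc n \<le> inverse (Suc N)" using \<open>n \<ge> N\<close> by (simp add: field_simps)
      then show "dist (poly (p n) x) (f x) < e"
        using p[OF \<open>x \<in> {a..b}\<close>, of n] N by (simp add: dist_real_def abs_minus_commute)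
    qed
  qed
  then show ?thesis using that by blast
qed

lemma poly_op_limit_mono:
  fixes T :: "'a::{real_inner,banach} \<Rightarrow>\<^sub>L 'a"
  assumes sym: "symmetric_op T"
    and p: "uniform_limit (real_spectrum T) (\<lambda>n. poly (p n)) f sequentially" "(\<lambda>n. poly_op (p n) T) \<longlonglongrightarrow> F"
    and q: "uniform_limit (real_spectrum T) (\<lambda>n. poly (q n)) g sequentially" "(\<lambda>n. poly_op (q n) T) \<longlonglongrightarrow> G"
    and le: "\<And>r. r \<in> real_spectrum T \<Longrightarrow> f r \<le> g r"
  shows "inner (blinfun_apply F x) x \<le> inner (blinfun_apply G x) x"
proof -
  have *: "inner (blinfun_apply F x) x \<le> inner (blinfun_apply G x) x + e * inner x x" if e: "e > 0" for e
  proof (rule tendsto_le)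
    show "(\<lambda>n. inner (blinfun_apply (poly_op (p n) T) x) x) \<longlonglongrightarrow> inner (blinfun_apply F x) x"
      by (intro tendsto_intros p)
    show "(\<lambda>n. inner (blinfun_apply (poly_op (q n) T) x) x + e * inner x x) \<longlonglongrightarrow>
       inner (blinfun_apply G x) x + e * inner x x"
      by (intro tendsto_intros q)
    have "\<forall>\<^sub>F n in sequentially. \<forall>r\<in>real_spectrum T. dist (poly (p n) r) (f r) < e/2"
      using uniform_limitD[OF p(1), of "e/2"] e by simp
    moreover have "\<forall>\<^sub>F n in sequentially. \<forall>r\<in>real_spectrum T. dist (poly (q n) r) (g r) < e/2"
      using uniform_limitD[OF q(1), of "e/2"] e by simp
    ultimately show "\<forall>\<^sub>F n in sequentially. inner (blinfun_apply (poly_op (p n) T) x) x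
        \<le> inner (blinfun_apply (poly_op (q n) T) x) x + e * inner x x"
    proof eventually_elim
      case (elim n)
      have "0 \<le> inner (blinfun_apply (poly_op (q n - p n + [:e:]) T) x) x"
      proof (rule poly_op_nonneg[OF sym])
        fix r assume r: "r \<in> real_spectrum T"
        have "dist (poly (p n) r) (f r) < e/2" "dist (poly (q n) r) (g r) < e/2" using elim r by auto
        then have "poly (p n) r < f r + e/2" "g r - e/2 < poly (q n) r"
          unfolding dist_real_def by linarith+
        then have "0 \<le> poly (q n) r - poly (p n) r + e" using le[OF r] by argo
        then show "0 \<le> poly (q n - p n + [:e:]) r" by simp
      qed
      then show ?case
        by (simp add: poly_op_diff poly_op_add blinfun.diff_left blinfun.add_left blinfun.scaleR_left
            inner_diff_left inner_add_left)
    qed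
  qed simp
  show ?thesis
  proof (rule field_le_epsilon)
    fix e :: real assume e: "e > 0"
    have d: "1 + inner x x > 0" by (simp add: add_pos_nonneg)
    have "e / (1 + inner x x) * inner x x \<le> e"
      using e d by (simp add: field_simps)
    then show "inner (blinfun_apply F x) x \<le> inner (blinfun_apply G x) x + e"
      using *[of "e / (1 + inner x x)"] e d by auto
  qed
qed

text \<open>All the operators \<open>log (T + e I)\<close> are limits of polynomials in the same operator \<open>T\<close>, obtained by
  shifting the argument. This is what makes different values of \<open>e\<close> comparable.\<close>
lemma op_fun_ln_approx:
  fixes T :: "'a::complex_hilbert_space \<Rightarrow>\<^sub>L 'a"
  assumes sym: "symmetric_op T" and nonneg: "\<And>x. 0 \<le> inner (blinfun_apply T x) x" and e: "e > 0"
  obtains q where "uniform_limit (real_spectrum T) (\<lambda>n. poly (q n)) (\<lambda>t. ln (t + e)) sequentially"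
    "(\<lambda>n. poly_op (q n) T) \<longlonglongrightarrow> op_fun ln (T + e *\<^sub>R id_blinfun)"
proof -
  define S where "S = T + e *\<^sub>R id_blinfun"
  have symS: "symmetric_op S"
    using sym by (simp add: S_def symmetric_op_def blinfun.add_left blinfun.scaleR_left inner_add_left inner_add_right)
  have "norm S \<le> norm T + e"
  proof -
    have "norm (e *\<^sub>R id_blinfun :: 'a \<Rightarrow>\<^sub>L 'a) \<le> e"
      using e mult_left_mono[OF norm_blinfun_id_le, of e] by simp
    then show ?thesis unfolding S_def by (rule order_trans[OF norm_triangle_ineq add_left_mono])
  qed
  moreover have "real_spectrum S \<subseteq> {e..norm S}"
    by (rule real_spectrum_bounds)
      (use nonneg in \<open>simp add: S_def blinfun.add_left blinfun.scaleR_left inner_add_left power2_norm_eq_inner\<close>)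
  ultimately have specS: "real_spectrum S \<subseteq> {e..norm T + e}" by auto
  have "real_spectrum T \<subseteq> {0..norm T}" by (rule real_spectrum_bounds) (use nonneg in simp)
  then have specT: "(\<lambda>t. t + e) ` real_spectrum T \<subseteq> {e..norm T + e}" by auto
  have "continuous_on {e..norm T + e} ln" using e by (auto intro!: continuous_intros)
  then obtain p where p: "uniform_limit {e..norm T + e} (\<lambda>n. poly (p n)) ln sequentially"
    by (rule Weierstrass_poly)
  have "(\<lambda>n. poly_op (p n) S) \<longlonglongrightarrow> op_fun ln S"
    using op_fun_tendsto[OF symS uniform_limit_on_subset[OF p specS]] .
  then have 1: "(\<lambda>n. poly_op (pcompose (p n) [:e, 1:]) T) \<longlonglongrightarrow> op_fun ln (T + e *\<^sub>R id_blinfun)"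
    by (simp add: poly_op_pcompose_shift S_def)
  have "uniform_limit (real_spectrum T) (\<lambda>n t. poly (p n) (t + e)) (\<lambda>t. ln (t + e)) sequentially"
    using p specT unfolding uniform_limit_iff by (fastforce elim: eventually_mono)
  moreover have "poly (pcompose (p n) [:e, 1:]) = (\<lambda>t. poly (p n) (t + e))" for n
    by (rule ext) (simp add: poly_pcompose add.commute)
  ultimately have "uniform_limit (real_spectrum T) (\<lambda>n. poly (pcompose (p n) [:e, 1:])) (\<lambda>t. ln (t + e)) sequentially"
    by simp
  then show ?thesis using 1 by (rule that)
qed

text \<open>Since the logarithm is increasing, so is \<open>\<langle>log (T + e I) x, x\<rangle>\<close> as a function of \<open>e\<close>; hence the limit defining
  the determinant exists, and \<open>ln t \<le> t - 1\<close> bounds it by \<open>\<langle>T x, x\<rangle> - 1\<close>.\<close>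
lemma fujii_seo_det_ge_1D:
  fixes T :: "'a::complex_hilbert_space \<Rightarrow>\<^sub>L 'a"
  assumes sym: "symmetric_op T" and nonneg: "\<And>x. 0 \<le> inner (blinfun_apply T x) x"
    and x: "norm x = 1" and det: "1 \<le> fujii_seo_det x T"
  shows "1 \<le> inner (blinfun_apply T x) x"
proof -
  define g where "g e = inner (blinfun_apply (op_fun ln (T + e *\<^sub>R id_blinfun)) x) x" for e
  define l where "l = Inf ((\<lambda>e. ereal (g e)) ` {0<..})"
  have spec: "r \<ge> 0" if "r \<in> real_spectrum T" for r
    using real_spectrum_bounds[of 0 T] nonneg that by auto
  have mono: "g d \<le> g e" if "0 < d" "d \<le> e" for d e
  proof -
    have "0 < e" using that by simp
    obtain p where p: "uniform_limit (real_spectrum T) (\<lambda>n. poly (p n)) (\<lambda>t. ln (t + d)) sequentially"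
      "(\<lambda>n. poly_op (p n) T) \<longlonglongrightarrow> op_fun ln (T + d *\<^sub>R id_blinfun)"
      using op_fun_ln_approx[OF sym nonneg \<open>0 < d\<close>] by blast
    obtain q where q: "uniform_limit (real_spectrum T) (\<lambda>n. poly (q n)) (\<lambda>t. ln (t + e)) sequentially"
      "(\<lambda>n. poly_op (q n) T) \<longlonglongrightarrow> op_fun ln (T + e *\<^sub>R id_blinfun)"
      using op_fun_ln_approx[OF sym nonneg \<open>0 < e\<close>] by blast
    show ?thesis unfolding g_def
      by (rule poly_op_limit_mono[OF sym p q]) (use spec that in \<open>auto simp: add_nonneg_pos\<close>)
  qed
  have upper: "g e \<le> inner (blinfun_apply T x) x + e - 1" if "0 < e" for e
  proof -
    obtain p where p: "uniform_limit (real_spectrum T) (\<lambda>n. poly (p n)) (\<lambda>t. ln (t + e)) sequentially"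
      "(\<lambda>n. poly_op (p n) T) \<longlonglongrightarrow> op_fun ln (T + e *\<^sub>R id_blinfun)"
      using op_fun_ln_approx[OF sym nonneg \<open>0 < e\<close>] by blast
    have "g e \<le> inner (blinfun_apply (poly_op [:e - 1, 1:] T) x) x"
      unfolding g_def
    proof (rule poly_op_limit_mono[OF sym p])
      show "uniform_limit (real_spectrum T) (\<lambda>n::nat. poly [:e - 1, 1:]) (\<lambda>t. t + e - 1) sequentially"
        by (intro uniform_limitI always_eventually) (auto simp: dist_real_def)
      show "ln (r + e) \<le> r + e - 1" if "r \<in> real_spectrum T" for r
        using ln_le_minus_one[of "r + e"] spec[OF that] \<open>0 < e\<close> by simp
    qed simp
    then show ?thesis using x
      by (simp add: blinfun.add_left blinfun.scaleR_left blinfun.diff_left inner_add_left norm_eq_1 algebra_simps)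
  qed
  have lim: "((\<lambda>e. ereal (g e)) \<longlongrightarrow> l) (at_right 0)"
    using Lim_right_bound[of UNIV 0 "\<lambda>e. ereal (g e)" "-\<infinity>"] mono by (simp add: l_def)
  then have Lim: "Lim (at_right 0) (\<lambda>e. ereal (g e)) = l" by (intro tendsto_Lim) auto
  have "((\<lambda>e. ereal (inner (blinfun_apply T x) x + e - 1)) \<longlongrightarrow> ereal (inner (blinfun_apply T x) x + 0 - 1)) (at_right 0)"
    by (intro tendsto_intros)
  then have "l \<le> ereal (inner (blinfun_apply T x) x + 0 - 1)"
    using lim by (rule tendsto_le[rotated]) (auto simp: eventually_at_right_less upper intro!: eventually_at_rightI[of 0 1])
  moreover have "l \<noteq> - \<infinity>" and "1 \<le> exp (real_of_ereal l)"
    using det Lim by (auto simp: fujii_seo_det_def g_def Let_def inner_eq_Re_cinner split: if_splits)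
  ultimately show ?thesis by (cases l) auto
qed

section \<open>Second derivatives and circle integrals\<close>

lemma DERIV_along_line:
  fixes f :: "'a::real_normed_vector \<Rightarrow> real"
  assumes "(f has_derivative f') (at (p + x *\<^sub>R v))"
  shows "((\<lambda>x. f (p + x *\<^sub>R v)) has_real_derivative f' v) (at x within X)"
proof -
  interpret f': bounded_linear f' using assms by (rule has_derivative_bounded_linear)
  have "((\<lambda>x. p + x *\<^sub>R v) has_derivative (\<lambda>y. y *\<^sub>R v)) (at x within X)"
    by (auto intro!: derivative_eq_intros)
  from has_derivative_compose[OF this assms]
  show ?thesis
    by (simp add: has_field_derivative_def f'.scaleR mult_commute_abs)
qed

text \<open>The mean value theorem, first along \<open>s\<close> and then along \<open>t\<close>. The left-hand side is symmetric in
  \<open>s\<close> and \<open>t\<close>, which is the source of the symmetry of second derivatives.\<close>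
lemma second_difference_mean_value:
  fixes u :: "'a::real_normed_vector \<Rightarrow> real" and u'' :: "'a \<Rightarrow> 'a \<Rightarrow>\<^sub>L 'a \<Rightarrow>\<^sub>L real"
  assumes u': "\<And>w. w \<in> S \<Longrightarrow> (u has_derivative blinfun_apply (u' w)) (at w)"
    and u'': "\<And>w. w \<in> S \<Longrightarrow> (u' has_derivative blinfun_apply (u'' w)) (at w)"
    and h: "0 < h" and S: "\<And>x y. x \<in> {0..h} \<Longrightarrow> y \<in> {0..h} \<Longrightarrow> a + x *\<^sub>R s + y *\<^sub>R t \<in> S"
  obtains x y where "x \<in> {0..h}" "y \<in> {0..h}"
    "u (a + h *\<^sub>R s + h *\<^sub>R t) - u (a + h *\<^sub>R s) - u (a + h *\<^sub>R t) + u a =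
     h\<^sup>2 * blinfun_apply (blinfun_apply (u'' (a + x *\<^sub>R s + y *\<^sub>R t)) t) s"
proof -
  have d1: "((\<lambda>x. u (a + y *\<^sub>R t + x *\<^sub>R s)) has_real_derivative blinfun_apply (u' (a + x *\<^sub>R s + y *\<^sub>R t)) s) (at x)"
    if "x \<in> {0..h}" "y \<in> {0..h}" for x y
    using DERIV_along_line[of u _ "a + y *\<^sub>R t" x s] u'[OF S[OF that]] by (simp add: algebra_simps)
  have "\<exists>x>0. x < h \<and> (u (a + h *\<^sub>R t + h *\<^sub>R s) - u (a + 0 *\<^sub>R t + h *\<^sub>R s)) - (u (a + h *\<^sub>R t + 0 *\<^sub>R s) - u (a + 0 *\<^sub>R t + 0 *\<^sub>R s)) =
     (h - 0) * (blinfun_apply (u' (a + x *\<^sub>R s + h *\<^sub>R t)) s - blinfun_apply (u' (a + x *\<^sub>R s + 0 *\<^sub>R t)) s)"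
    by (rule MVT2[OF h]) (intro DERIV_diff d1; use h in simp)
  then obtain x where x: "0 < x" "x < h" and eq: "u (a + h *\<^sub>R s + h *\<^sub>R t) - u (a + h *\<^sub>R s) - u (a + h *\<^sub>R t) + u a =
     h * (blinfun_apply (u' (a + x *\<^sub>R s + h *\<^sub>R t)) s - blinfun_apply (u' (a + x *\<^sub>R s)) s)"
    by (auto simp: algebra_simps)
  have d2: "((\<lambda>y. blinfun_apply (u' (a + x *\<^sub>R s + y *\<^sub>R t)) s) has_real_derivative
      blinfun_apply (blinfun_apply (u'' (a + x *\<^sub>R s + y *\<^sub>R t)) t) s) (at y)" if "y \<in> {0..h}" for y
  proof -
    have "a + x *\<^sub>R s + y *\<^sub>R t \<in> S" using S that x by simp
    then have "((\<lambda>w. blinfun_apply (u' w) s) has_derivative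
        (\<lambda>v. blinfun_apply (blinfun_apply (u'' (a + x *\<^sub>R s + y *\<^sub>R t)) v) s)) (at (a + x *\<^sub>R s + y *\<^sub>R t))"
      by (intro bounded_linear.has_derivative[OF blinfun.bounded_linear_left[of s]] u'')
    then show ?thesis by (rule DERIV_along_line)
  qed
  have "\<exists>y>0. y < h \<and> blinfun_apply (u' (a + x *\<^sub>R s + h *\<^sub>R t)) s - blinfun_apply (u' (a + x *\<^sub>R s + 0 *\<^sub>R t)) s =
     (h - 0) * blinfun_apply (blinfun_apply (u'' (a + x *\<^sub>R s + y *\<^sub>R t)) t) s"
    by (rule MVT2[OF h]) (use d2 in auto)
  then obtain y where "0 < y" "y < h" "blinfun_apply (u' (a + x *\<^sub>R s + h *\<^sub>R t)) s - blinfun_apply (u' (a + x *\<^sub>R s)) s =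
     h * blinfun_apply (blinfun_apply (u'' (a + x *\<^sub>R s + y *\<^sub>R t)) t) s"
    by auto
  then show ?thesis using x eq that[of x y] by (simp add: power2_eq_square)
qed

text \<open>The same second difference is computed in both orders on ever smaller parallelograms at \<open>a\<close>.\<close>
lemma second_derivative_symmetric:
  fixes u :: "'a::real_normed_vector \<Rightarrow> real" and u'' :: "'a \<Rightarrow> 'a \<Rightarrow>\<^sub>L 'a \<Rightarrow>\<^sub>L real"
  assumes "open S" "a \<in> S"
    and u': "\<And>w. w \<in> S \<Longrightarrow> (u has_derivative blinfun_apply (u' w)) (at w)"
    and u'': "\<And>w. w \<in> S \<Longrightarrow> (u' has_derivative blinfun_apply (u'' w)) (at w)"
    and cont: "continuous_on S u''"
  shows "blinfun_apply (blinfun_apply (u'' a) s) t = blinfun_apply (blinfun_apply (u'' a) t) s"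
proof -
  have le: "dist (blinfun_apply (blinfun_apply (u'' a) s) t) (blinfun_apply (blinfun_apply (u'' a) t) s) \<le> 2 * e"
    if "e > 0" for e
  proof -
    have isc: "isCont u'' a" using cont \<open>open S\<close> \<open>a \<in> S\<close> continuous_on_eq_continuous_at by blast
    have ev: "\<forall>\<^sub>F w in nhds a. dist (blinfun_apply (blinfun_apply (u'' w) p) q) (blinfun_apply (blinfun_apply (u'' a) p) q) < e" for p q
    proof -
      have "isCont (\<lambda>w. blinfun_apply (blinfun_apply (u'' w) p) q) a" by (intro continuous_intros isc)
      then have "((\<lambda>w. blinfun_apply (blinfun_apply (u'' w) p) q) \<longlongrightarrow> blinfun_apply (blinfun_apply (u'' a) p) q) (nhds a)"
        using tendsto_at_iff_tendsto_nhds[of "\<lambda>w. blinfun_apply (blinfun_apply (u'' w) p) q" a]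
        by (simp add: continuous_at)
      then show ?thesis using tendstoD \<open>e > 0\<close> by blast
    qed
    have "\<forall>\<^sub>F w in nhds a. w \<in> S" using \<open>open S\<close> \<open>a \<in> S\<close> by (rule eventually_nhds_in_open)
    from eventually_conj[OF this eventually_conj[OF ev[of s t] ev[of t s]]]
    obtain d where d: "d > 0" and near: "\<And>w. dist w a < d \<Longrightarrow> w \<in> S \<and>
      dist (blinfun_apply (blinfun_apply (u'' w) s) t) (blinfun_apply (blinfun_apply (u'' a) s) t) < e \<and>
      dist (blinfun_apply (blinfun_apply (u'' w) t) s) (blinfun_apply (blinfun_apply (u'' a) t) s) < e"
      unfolding eventually_nhds_metric by blast
    \<comment> \<open>With this side length the parallelogram lies in the ball of radius \<open>d\<close> around \<open>a\<close>.\<close>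
    define h where "h = d / (norm s + norm t + 1)"
    have pos: "norm s + norm t + 1 > 0" by (simp add: add_nonneg_pos)
    have h: "h > 0" using d pos by (simp add: h_def)
    have close: "dist (a + x *\<^sub>R s + y *\<^sub>R t) a < d" if "x \<in> {0..h}" "y \<in> {0..h}" for x y
    proof -
      have "dist (a + x *\<^sub>R s + y *\<^sub>R t) a \<le> x * norm s + y * norm t"
        using norm_triangle_ineq[of "x *\<^sub>R s" "y *\<^sub>R t"] that by (simp add: dist_norm)
      also have "\<dots> \<le> h * norm s + h * norm t"
        using that by (intro add_mono mult_right_mono) auto
      also have "\<dots> < h * (norm s + norm t + 1)" using h by (simp add: algebra_simps)
      also have "\<dots> = d" using pos by (simp add: h_def)
      finally show ?thesis .
    qed
    have close': "dist (a + x *\<^sub>R t + y *\<^sub>R s) a < d" if "x \<in> {0..h}" "y \<in> {0..h}" for x y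
      using close[OF that(2,1)] by (simp add: algebra_simps)
    obtain x y where xy: "x \<in> {0..h}" "y \<in> {0..h}"
      "u (a + h *\<^sub>R s + h *\<^sub>R t) - u (a + h *\<^sub>R s) - u (a + h *\<^sub>R t) + u a =
       h\<^sup>2 * blinfun_apply (blinfun_apply (u'' (a + x *\<^sub>R s + y *\<^sub>R t)) t) s"
      by (rule second_difference_mean_value[OF u' u'' h, where a=a and s=s and t=t]) (use near[OF close] in auto)
    obtain x' y' where xy': "x' \<in> {0..h}" "y' \<in> {0..h}"
      "u (a + h *\<^sub>R t + h *\<^sub>R s) - u (a + h *\<^sub>R t) - u (a + h *\<^sub>R s) + u a =
       h\<^sup>2 * blinfun_apply (blinfun_apply (u'' (a + x' *\<^sub>R t + y' *\<^sub>R s)) s) t"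
      by (rule second_difference_mean_value[OF u' u'' h, where a=a and s=t and t=s]) (use near[OF close'] in auto)
    have "u (a + h *\<^sub>R t + h *\<^sub>R s) - u (a + h *\<^sub>R t) - u (a + h *\<^sub>R s) + u a =
      u (a + h *\<^sub>R s + h *\<^sub>R t) - u (a + h *\<^sub>R s) - u (a + h *\<^sub>R t) + u a" by (simp add: algebra_simps)
    then have "blinfun_apply (blinfun_apply (u'' (a + x' *\<^sub>R t + y' *\<^sub>R s)) s) t =
      blinfun_apply (blinfun_apply (u'' (a + x *\<^sub>R s + y *\<^sub>R t)) t) s"
      using xy(3) xy'(3) h by simp
    then show ?thesis
      using near[OF close[OF xy(1,2)]] near[OF close'[OF xy'(1,2)]] unfolding dist_real_def by argo
  qed
  show ?thesis
  proof (rule ccontr)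
    assume "\<not> ?thesis"
    then show False
      using le[of "dist (blinfun_apply (blinfun_apply (u'' a) s) t) (blinfun_apply (blinfun_apply (u'' a) t) s) / 4"] by simp
  qed
qed

text \<open>Let \<open>M r\<close> be the integral over the circle of radius \<open>r\<close>. Then \<open>(r M')' = r \<integral> \<Delta>u\<close>, where the Laplacian in the
  coordinates along \<open>h\<close> and \<open>k\<close> is at least \<open>c\<close>. Integrating twice from the centre gives \<open>M 1 - M 0 \<ge> \<pi> c / 2\<close>.\<close>
lemma circle_integral_lower_bound:
  fixes u :: "'a::real_normed_vector \<Rightarrow> real" and u'' :: "'a \<Rightarrow> 'a \<Rightarrow>\<^sub>L 'a \<Rightarrow>\<^sub>L real"
  assumes u': "\<And>w. w \<in> S \<Longrightarrow> (u has_derivative blinfun_apply (u' w)) (at w)"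
    and u'': "\<And>w. w \<in> S \<Longrightarrow> (u' has_derivative blinfun_apply (u'' w)) (at w)"
    and cont: "continuous_on S u''"
    and disc: "\<And>x y. x\<^sup>2 + y\<^sup>2 \<le> 1 \<Longrightarrow> z + x *\<^sub>R h + y *\<^sub>R k \<in> S"
    and lower: "\<And>w. w \<in> S \<Longrightarrow> c \<le> blinfun_apply (blinfun_apply (u'' w) h) h + blinfun_apply (blinfun_apply (u'' w) k) k"
  shows "2 * pi * u z + pi / 2 * c \<le> integral {0..2*pi} (\<lambda>\<theta>. u (z + (cos \<theta> *\<^sub>R h + sin \<theta> *\<^sub>R k)))"
proof -
  define e e' where "e \<theta> = cos \<theta> *\<^sub>R h + sin \<theta> *\<^sub>R k" and "e' \<theta> = (- sin \<theta>) *\<^sub>R h + cos \<theta> *\<^sub>R k" for \<theta>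
  define w where "w r \<theta> = z + r *\<^sub>R e \<theta>" for r \<theta>
  have wS: "w r \<theta> \<in> S" if "r \<in> {0..1}" for r \<theta>
  proof -
    have "(r * cos \<theta>)\<^sup>2 + (r * sin \<theta>)\<^sup>2 = r\<^sup>2"
      by (simp add: power_mult_distrib distrib_left[symmetric])
    also have "\<dots> \<le> 1" using that by (simp add: power_le_one)
    finally show ?thesis using disc[of "r * cos \<theta>" "r * sin \<theta>"] by (simp add: w_def e_def algebra_simps)
  qed
  have ce: "continuous_on X (\<lambda>p. e (g p))" "continuous_on X (\<lambda>p. e' (g p))" if "continuous_on X g" for X :: "'b::t2_space set" and g
    unfolding e_def e'_def by (intro continuous_intros that)+
  have cw: "continuous_on X (\<lambda>p. w (f p) (g p))" if "continuous_on X f" "continuous_on X g" for X :: "'b::t2_space set" and f g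
    unfolding w_def by (intro continuous_intros that ce)
  have cS: "continuous_on S u" "continuous_on S u'"
    by (auto intro!: continuous_at_imp_continuous_on has_derivative_continuous u' u'')
  have cu: "continuous_on X (\<lambda>p. u (w (f p) (g p)))" "continuous_on X (\<lambda>p. u' (w (f p) (g p)))"
      "continuous_on X (\<lambda>p. u'' (w (f p) (g p)))"
    if "continuous_on X f" "continuous_on X g" "\<And>p. p \<in> X \<Longrightarrow> f p \<in> {0..1}" for X :: "'b::t2_space set" and f g
  proof -
    have sub: "(\<lambda>p. w (f p) (g p)) ` X \<subseteq> S" using wS that(3) by blast
    show "continuous_on X (\<lambda>p. u (w (f p) (g p)))" "continuous_on X (\<lambda>p. u' (w (f p) (g p)))"
      "continuous_on X (\<lambda>p. u'' (w (f p) (g p)))"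
      by (rule continuous_on_compose2[OF _ cw[OF that(1,2)] sub], rule cS cont)+
  qed
  \<comment> \<open>\<open>N\<close> and \<open>P\<close> are the first and second derivative of \<open>M\<close>; \<open>Q\<close> is the integral of the second tangential derivative.\<close>
  define M where "M r = integral {0..2*pi} (\<lambda>\<theta>. u (w r \<theta>))" for r
  define N where "N r = integral {0..2*pi} (\<lambda>\<theta>. blinfun_apply (u' (w r \<theta>)) (e \<theta>))" for r
  define P where "P r = integral {0..2*pi} (\<lambda>\<theta>. blinfun_apply (blinfun_apply (u'' (w r \<theta>)) (e \<theta>)) (e \<theta>))" for r
  define Q where "Q r = integral {0..2*pi} (\<lambda>\<theta>. blinfun_apply (blinfun_apply (u'' (w r \<theta>)) (e' \<theta>)) (e' \<theta>))" for r
  have du'': "((\<lambda>v. blinfun_apply (u' v) x) has_derivative (\<lambda>y. blinfun_apply (blinfun_apply (u'' v) y) x)) (at v)"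
    if "v \<in> S" for v x
    by (intro bounded_linear.has_derivative[OF blinfun.bounded_linear_left[of x]] u'' that)
  have M': "(M has_real_derivative N r) (at r within {0..1})" if "r \<in> {0..1}" for r
  proof -
    have "((\<lambda>r. integral (cbox 0 (2*pi)) (\<lambda>\<theta>. u (w r \<theta>))) has_real_derivative
      integral (cbox 0 (2*pi)) (\<lambda>\<theta>. blinfun_apply (u' (w r \<theta>)) (e \<theta>))) (at r within {0..1})"
    proof (rule leibniz_rule_field_derivative[where fx = "\<lambda>r \<theta>. blinfun_apply (u' (w r \<theta>)) (e \<theta>)"])
      fix x t :: real assume "x \<in> {0..1}"
      then show "((\<lambda>x. u (w x t)) has_real_derivative blinfun_apply (u' (w x t)) (e t)) (at x within {0..1})"
        unfolding w_def by (rule DERIV_along_line[OF u'[OF wS, unfolded w_def]])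
    next
      fix x :: real assume "x \<in> {0..1}"
      then show "(\<lambda>\<theta>. u (w x \<theta>)) integrable_on cbox 0 (2 * pi)"
        by (intro integrable_continuous cu continuous_intros) auto
    next
      show "continuous_on ({0..1} \<times> cbox 0 (2 * pi)) (\<lambda>(x, t). blinfun_apply (u' (w x t)) (e t))"
        unfolding split_beta by (intro continuous_intros cu ce) auto
    qed (use that in auto)
    then show ?thesis by (simp add: M_def[abs_def] N_def[abs_def] P_def)
  qed
  have N': "(N has_real_derivative P r) (at r within {0..1})" if "r \<in> {0..1}" for r
  proof -
    have "((\<lambda>r. integral (cbox 0 (2*pi)) (\<lambda>\<theta>. blinfun_apply (u' (w r \<theta>)) (e \<theta>))) has_real_derivative
      integral (cbox 0 (2*pi)) (\<lambda>\<theta>. blinfun_apply (blinfun_apply (u'' (w r \<theta>)) (e \<theta>)) (e \<theta>))) (at r within {0..1})"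
    proof (rule leibniz_rule_field_derivative[where fx = "\<lambda>r \<theta>. blinfun_apply (blinfun_apply (u'' (w r \<theta>)) (e \<theta>)) (e \<theta>)"])
      fix x t :: real assume "x \<in> {0..1}"
      then show "((\<lambda>x. blinfun_apply (u' (w x t)) (e t)) has_real_derivative blinfun_apply (blinfun_apply (u'' (w x t)) (e t)) (e t)) (at x within {0..1})"
        unfolding w_def by (rule DERIV_along_line[OF du''[OF wS, unfolded w_def]])
    next
      fix x :: real assume "x \<in> {0..1}"
      then show "(\<lambda>\<theta>. blinfun_apply (u' (w x \<theta>)) (e \<theta>)) integrable_on cbox 0 (2 * pi)"
        by (intro integrable_continuous cu ce continuous_intros) auto
    next
      show "continuous_on ({0..1} \<times> cbox 0 (2 * pi)) (\<lambda>(x, t). blinfun_apply (blinfun_apply (u'' (w x t)) (e t)) (e t))"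
        unfolding split_beta by (intro continuous_intros cu ce) auto
    qed (use that in auto)
    then show ?thesis by (simp add: M_def[abs_def] N_def[abs_def] P_def)
  qed
  have int: "(\<lambda>\<theta>. blinfun_apply (u' (w r \<theta>)) (e \<theta>)) integrable_on {0..2*pi}"
    "(\<lambda>\<theta>. blinfun_apply (blinfun_apply (u'' (w r \<theta>)) (e \<theta>)) (e \<theta>)) integrable_on {0..2*pi}"
    "(\<lambda>\<theta>. blinfun_apply (blinfun_apply (u'' (w r \<theta>)) (e' \<theta>)) (e' \<theta>)) integrable_on {0..2*pi}"
    if "r \<in> {0..1}" for r
    using that by (auto intro!: integrable_continuous_interval continuous_intros cu ce)
  \<comment> \<open>The tangential derivative \<open>u' (w r \<theta>) (e' \<theta>)\<close> is periodic in \<open>\<theta>\<close>, so its derivative integrates to zero.\<close>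
  have NQ: "N r = r * Q r" if r: "r \<in> {0..1}" for r
  proof -
    have "((\<lambda>\<theta>. r * blinfun_apply (blinfun_apply (u'' (w r \<theta>)) (e' \<theta>)) (e' \<theta>) - blinfun_apply (u' (w r \<theta>)) (e \<theta>))
       has_integral (blinfun_apply (u' (w r (2*pi))) (e' (2*pi)) - blinfun_apply (u' (w r 0)) (e' 0))) {0..2*pi}"
    proof (rule fundamental_theorem_of_calculus)
      fix \<theta>
      have de': "(e' has_vector_derivative - e \<theta>) (at \<theta> within {0..2*pi})"
        unfolding e_def e'_def
        by (auto intro!: derivative_eq_intros simp: has_vector_derivative_def algebra_simps)
      have dw: "(w r has_vector_derivative r *\<^sub>R e' \<theta>) (at \<theta> within {0..2*pi})"
        unfolding e_def e'_def w_def
        by (auto intro!: derivative_eq_intros simp: has_vector_derivative_def algebra_simps)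
      have "((\<lambda>\<theta>. u' (w r \<theta>)) has_vector_derivative blinfun_apply (u'' (w r \<theta>)) (r *\<^sub>R e' \<theta>)) (at \<theta> within {0..2*pi})"
        using has_derivative_compose[OF dw[unfolded has_vector_derivative_def] u''[OF wS[OF r]]]
        by (simp add: has_vector_derivative_def blinfun.scaleR_right)
      from bounded_bilinear.has_vector_derivative[OF bounded_bilinear_blinfun_apply this de']
      show "((\<lambda>\<theta>. blinfun_apply (u' (w r \<theta>)) (e' \<theta>)) has_vector_derivative
         r * blinfun_apply (blinfun_apply (u'' (w r \<theta>)) (e' \<theta>)) (e' \<theta>) - blinfun_apply (u' (w r \<theta>)) (e \<theta>)) (at \<theta> within {0..2*pi})"
        by (simp add: blinfun.scaleR_right blinfun.scaleR_left blinfun.minus_right)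
    qed simp
    moreover have "w r (2*pi) = w r 0" "e' (2*pi) = e' 0" by (simp_all add: w_def e_def e'_def)
    ultimately have "((\<lambda>\<theta>. r * blinfun_apply (blinfun_apply (u'' (w r \<theta>)) (e' \<theta>)) (e' \<theta>) - blinfun_apply (u' (w r \<theta>)) (e \<theta>))
       has_integral 0) {0..2*pi}" by simp
    moreover have "((\<lambda>\<theta>. r * blinfun_apply (blinfun_apply (u'' (w r \<theta>)) (e' \<theta>)) (e' \<theta>) - blinfun_apply (u' (w r \<theta>)) (e \<theta>))
       has_integral r * Q r - N r) {0..2*pi}"
      unfolding Q_def N_def
      by (intro has_integral_diff has_integral_mult_right integrable_integral int r)
    ultimately have "0 = r * Q r - N r" by (rule has_integral_unique)
    then show ?thesis by simp
  qed
  \<comment> \<open>The sum of the second derivatives along \<open>e\<close> and \<open>e'\<close> is invariant under rotation, so it equals that along \<open>h\<close> and \<open>k\<close>.\<close>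
  have PQ: "2 * pi * c \<le> P r + Q r" if r: "r \<in> {0..1}" for r
  proof -
    have "P r + Q r = integral {0..2*pi} (\<lambda>\<theta>. blinfun_apply (blinfun_apply (u'' (w r \<theta>)) (e \<theta>)) (e \<theta>)
       + blinfun_apply (blinfun_apply (u'' (w r \<theta>)) (e' \<theta>)) (e' \<theta>))"
      unfolding P_def Q_def by (rule integral_add[symmetric]; rule int[OF r])
    moreover have "integral {0..2*pi} (\<lambda>\<theta>. c) \<le> \<dots>"
    proof (rule integral_le)
      fix \<theta>
      let ?B = "\<lambda>x y. blinfun_apply (blinfun_apply (u'' (w r \<theta>)) x) y"
      have "?B (a *\<^sub>R h + b *\<^sub>R k) (a *\<^sub>R h + b *\<^sub>R k) + ?B ((- b) *\<^sub>R h + a *\<^sub>R k) ((- b) *\<^sub>R h + a *\<^sub>R k)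
        = (a\<^sup>2 + b\<^sup>2) * (?B h h + ?B k k)" for a b
        by (simp add: blinfun.add_left blinfun.add_right blinfun.diff_left blinfun.diff_right blinfun.minus_left
          blinfun.minus_right blinfun.scaleR_left blinfun.scaleR_right power2_eq_square algebra_simps)
      from this[of "cos \<theta>" "sin \<theta>"] have "?B (e \<theta>) (e \<theta>) + ?B (e' \<theta>) (e' \<theta>) = ?B h h + ?B k k"
        by (simp add: e_def e'_def)
      then show "c \<le> ?B (e \<theta>) (e \<theta>) + ?B (e' \<theta>) (e' \<theta>)" using lower[OF wS[OF r]] by simp
    qed (auto intro!: integrable_add int r)
    ultimately show ?thesis by simp
  qed
  have at: "at r within {0..1} = at r" if "0 < r" "r < 1" for r :: real
    using that by (intro at_within_interior) auto
  have N_ge: "pi * c * r\<^sup>2 \<le> r * N r" if r: "r \<in> {0..1}" for r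
  proof -
    have "0 * N 0 - pi * c * 0\<^sup>2 \<le> r * N r - pi * c * r\<^sup>2"
    proof (rule DERIV_nonneg_imp_increasing_open[where f = "\<lambda>r. r * N r - pi * c * r\<^sup>2"])
      show "continuous_on {0..r} (\<lambda>r. r * N r - pi * c * r\<^sup>2)"
        using r by (intro continuous_intros continuous_on_subset[OF DERIV_continuous_on[OF N']]) auto
      fix x assume x: "0 < x" "x < r"
      then have x1: "x \<in> {0..1}" "0 < x" "x < 1" using r by auto
      have "((\<lambda>r. r * N r - pi * c * r\<^sup>2) has_real_derivative (x * (P x + Q x) - x * (2 * pi * c))) (at x)"
        using N'[OF x1(1)] unfolding at[OF x1(2,3)]
        by (auto intro!: derivative_eq_intros simp: NQ[OF x1(1)] algebra_simps)
      moreover have "x * (2 * pi * c) \<le> x * (P x + Q x)" using PQ[OF x1(1)] x by (intro mult_left_mono) auto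
      ultimately show "\<exists>y. ((\<lambda>r. r * N r - pi * c * r\<^sup>2) has_real_derivative y) (at x) \<and> 0 \<le> y"
        by (meson diff_ge_0_iff_ge)
    qed (use r in auto)
    then show ?thesis by simp
  qed
  have "M 0 - pi * c / 2 * 0\<^sup>2 \<le> M 1 - pi * c / 2 * 1\<^sup>2"
  proof (rule DERIV_nonneg_imp_increasing_open[where f = "\<lambda>r. M r - pi * c / 2 * r\<^sup>2"])
    show "continuous_on {0..1} (\<lambda>r. M r - pi * c / 2 * r\<^sup>2)"
      by (intro continuous_intros DERIV_continuous_on[OF M'])
    fix x :: real assume x: "0 < x" "x < 1"
    then have x1: "x \<in> {0..1}" by auto
    have "((\<lambda>r. M r - pi * c / 2 * r\<^sup>2) has_real_derivative (N x - pi * c * x)) (at x)"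
      using M'[OF x1] unfolding at[OF x] by (auto intro!: derivative_eq_intros)
    moreover have "pi * c * x \<le> N x"
      using N_ge[OF x1] x by (simp add: power2_eq_square)
    ultimately show "\<exists>y. ((\<lambda>r. M r - pi * c / 2 * r\<^sup>2) has_real_derivative y) (at x) \<and> 0 \<le> y"
      by (meson diff_ge_0_iff_ge)
  qed simp
  then show ?thesis by (simp add: M_def w_def e_def)
qed

section \<open>Scalar multiplication and the Levi operator\<close>

lemma cinner_scaleC_right: "cinner x (c *\<^sub>C y) = cnj c * cinner x (y::'a::complex_hilbert_space)"
  by (metis cinner_commute cinner_scaleC_left complex_cnj_mult complex_cnj_cnj)

lemma norm_scaleC: "norm (c *\<^sub>C x) = cmod c * norm (x::'a::complex_hilbert_space)"
proof -
  have "cinner (c *\<^sub>C x) (c *\<^sub>C x) = complex_of_real ((cmod c)\<^sup>2) * cinner x x"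
    unfolding complex_norm_square by (simp add: cinner_scaleC_left cinner_scaleC_right)
  then have "(norm (c *\<^sub>C x))\<^sup>2 = (cmod c * norm x)\<^sup>2"
    by (simp add: power2_norm_eq_inner inner_eq_Re_cinner power_mult_distrib)
  then show ?thesis by simp
qed

lemma scaleC_Re_Im: "c *\<^sub>C x = Re c *\<^sub>R x + Im c *\<^sub>R (\<i> *\<^sub>C (x::'a::complex_hilbert_space))"
proof -
  have "c = complex_of_real (Re c) + complex_of_real (Im c) * \<i>" by (simp add: complex_eq_iff)
  then show ?thesis by (metis scaleC_add_left scaleC_scaleC scaleR_scaleC)
qed

lemma continuous_on_scaleC_left:
  assumes "continuous_on X f"
  shows "continuous_on X (\<lambda>t. f t *\<^sub>C (x::'a::complex_hilbert_space))"
  by (subst scaleC_Re_Im) (intro continuous_intros assms)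

lemma bounded_linear_scaleC_i: "bounded_linear (\<lambda>x::'a::complex_hilbert_space. \<i> *\<^sub>C x)"
  by (rule bounded_linear_intro[of _ 1])
    (auto simp: scaleC_add_right scaleR_scaleC scaleC_scaleC norm_scaleC mult.commute)

lemma scaleC_i_i: "\<i> *\<^sub>C \<i> *\<^sub>C x = - (x::'a::complex_hilbert_space)"
  using scaleR_scaleC[of "-1" x] by (simp add: scaleC_scaleC)

lemma bounded_bilinear_represented:
  fixes B :: "'a::{real_inner,banach} \<Rightarrow> 'a \<Rightarrow> real"
  assumes "bounded_bilinear B"
  obtains A :: "'a \<Rightarrow>\<^sub>L 'a" where "\<And>s t. inner (blinfun_apply A s) t = B s t"
proof -
  interpret B: bounded_bilinear B by fact
  have "\<exists>a. \<forall>t. B s t = inner a t" for s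
    using Riesz_representation[OF B.bounded_linear_right[of s]] by metis
  then obtain F where F: "\<And>s t. inner (F s) t = B s t" by metis
  obtain K where K: "K > 0" "\<And>s t. norm (B s t) \<le> norm s * norm t * K" using B.pos_bounded by metis
  have "bounded_linear F"
  proof (rule bounded_linear_intro)
    show "F (x + y) = F x + F y" for x y
      by (subst vector_eq_rdot[symmetric]) (simp add: F B.add_left inner_add_left)
    show "F (r *\<^sub>R x) = r *\<^sub>R F x" for r x
      by (subst vector_eq_rdot[symmetric]) (simp add: F B.scaleR_left)
    show "norm (F x) \<le> norm x * K" for x
    proof -
      have "norm (F x) * norm (F x) \<le> norm (F x) * (norm x * K)"
        using K(2)[of x "F x"] F[of x "F x"] by (simp add: dot_square_norm power2_eq_square mult_ac)
      then show ?thesis using K(1) by (cases "F x = 0") auto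
    qed
  qed
  then show ?thesis using that[of "Blinfun F"] F by (simp add: bounded_linear_Blinfun_apply)
qed

text \<open>The two summands are represented separately as real bilinear forms. The real part of the Levi form determines
  the operator, and \<open>i\<^sup>2 = - 1\<close> makes the imaginary parts agree.\<close>
lemma inner_levi_op:
  fixes u :: "'a::complex_hilbert_space \<Rightarrow> real"
  defines "D \<equiv> \<lambda>a s t. blinfun_apply (blinfun_apply (frechet_diff2 u a) s) t"
  shows "inner (blinfun_apply (levi_op u a) s) t = (D a s t + D a (\<i> *\<^sub>C s) (\<i> *\<^sub>C t)) / 4"
proof -
  have D: "bounded_linear (blinfun_apply (frechet_diff2 u a))" by (rule blinfun.bounded_linear_right)
  have "bounded_bilinear (\<lambda>s t. D a s t)"
    unfolding D_def by (rule bounded_bilinear.comp[OF bounded_bilinear_blinfun_apply D bounded_linear_ident])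
  then obtain A1 :: "'a \<Rightarrow>\<^sub>L 'a" where A1: "\<And>s t. inner (blinfun_apply A1 s) t = D a s t"
    using bounded_bilinear_represented by blast
  have "bounded_bilinear (\<lambda>s t. D a (\<i> *\<^sub>C s) (\<i> *\<^sub>C t))"
    unfolding D_def
    by (rule bounded_bilinear.comp[OF bounded_bilinear_blinfun_apply
          bounded_linear_compose[OF D bounded_linear_scaleC_i] bounded_linear_scaleC_i])
  then obtain A2 :: "'a \<Rightarrow>\<^sub>L 'a" where A2: "\<And>s t. inner (blinfun_apply A2 s) t = D a (\<i> *\<^sub>C s) (\<i> *\<^sub>C t)"
    using bounded_bilinear_represented by blast
  define A where "A = (1/4) *\<^sub>R (A1 + A2)"
  have A: "inner (blinfun_apply A s) t = (D a s t + D a (\<i> *\<^sub>C s) (\<i> *\<^sub>C t)) / 4" for s t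
    by (simp add: A_def blinfun.scaleR_left blinfun.add_left inner_add_left A1 A2)
  have "levi_op u a = A"
    unfolding levi_op_def
  proof (rule the_equality)
    show "\<forall>s t. cinner (blinfun_apply A s) t = levi_form u a s t"
    proof (intro allI complex_eqI)
      fix s t
      show "Re (cinner (blinfun_apply A s) t) = Re (levi_form u a s t)"
        by (simp add: inner_eq_Re_cinner[symmetric] A levi_form_def D_def)
      show "Im (cinner (blinfun_apply A s) t) = Im (levi_form u a s t)"
        by (simp add: cinner_Im A levi_form_def D_def scaleC_i_i blinfun.minus_right)
    qed
  next
    fix A' :: "'a \<Rightarrow>\<^sub>L 'a" assume A': "\<forall>s t. cinner (blinfun_apply A' s) t = levi_form u a s t"
    show "A' = A"
    proof (rule blinfun_eqI)
      fix s
      have "inner (blinfun_apply A' s) t = inner (blinfun_apply A s) t" for t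
        unfolding A by (simp add: inner_eq_Re_cinner A' levi_form_def D_def)
      then show "blinfun_apply A' s = blinfun_apply A s"
        using vector_eq_rdot[of "blinfun_apply A' s" "blinfun_apply A s"] by simp
    qed
  qed
  then show ?thesis using A by simp
qed

section \<open>Circle means, plurisubharmonicity and the maximum principle\<close>

lemma circle_mean_continuous:
  fixes v :: "'a::complex_hilbert_space \<Rightarrow> real"
  assumes cont: "continuous_on {0..2*pi} (\<lambda>\<theta>. v (z + cis \<theta> *\<^sub>C h))"
  shows "circle_mean (\<lambda>w. ereal (v w)) z h = ereal (integral {0..2*pi} (\<lambda>\<theta>. v (z + cis \<theta> *\<^sub>C h)) / (2*pi))"
proof -
  define f where "f \<theta> = v (z + cis \<theta> *\<^sub>C h)" for \<theta>
  define g where "g \<theta> = indicator {0..2*pi} \<theta> *\<^sub>R f \<theta>" for \<theta>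
  have si: "set_integrable lborel {0..2*pi} f"
    unfolding f_def by (rule borel_integrable_atLeastAtMost') (rule cont)
  then have gi: "integrable lborel g" by (simp add: set_integrable_def g_def[abs_def])
  have 1: "(\<integral>\<^sup>+\<theta>\<in>{0..2*pi}. e2ennreal (ereal (f \<theta>)) \<partial>lborel) = (\<integral>\<^sup>+\<theta>. ennreal (g \<theta>) \<partial>lborel)"
    by (intro nn_integral_cong) (auto simp: g_def split: split_indicator)
  have 2: "(\<integral>\<^sup>+\<theta>\<in>{0..2*pi}. e2ennreal (- ereal (f \<theta>)) \<partial>lborel) = (\<integral>\<^sup>+\<theta>. ennreal (- g \<theta>) \<partial>lborel)"
    by (intro nn_integral_cong) (auto simp: g_def split: split_indicator)
  have fin: "enn2ereal x = ereal (enn2real x)" if "x \<noteq> \<infinity>" for x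
    using that by (cases x) auto
  have "enn2ereal (\<integral>\<^sup>+\<theta>. ennreal (g \<theta>) \<partial>lborel) - enn2ereal (\<integral>\<^sup>+\<theta>. ennreal (- g \<theta>) \<partial>lborel)
    = ereal (integral\<^sup>L lborel g)"
    unfolding real_lebesgue_integral_def[OF gi]
    using gi by (subst (1 2) fin) (auto simp: real_integrable_def)
  also have "integral\<^sup>L lborel g = integral {0..2*pi} f"
    using set_borel_integral_eq_integral(2)[OF si] by (simp add: set_lebesgue_integral_def g_def[abs_def])
  finally show ?thesis
    unfolding circle_mean_def f_def[symmetric] 1 2 by (simp add: f_def[abs_def])
qed

lemma continuous_on_circle:
  fixes v :: "'a::complex_hilbert_space \<Rightarrow> 'b::topological_space"
  assumes "continuous_on S v" "\<And>c. cmod c \<le> 1 \<Longrightarrow> z + c *\<^sub>C h \<in> S"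
  shows "continuous_on X (\<lambda>\<theta>. v (z + cis \<theta> *\<^sub>C h))"
proof (rule continuous_on_compose2[OF assms(1)])
  show "continuous_on X (\<lambda>\<theta>. z + cis \<theta> *\<^sub>C h)"
    unfolding cis_conv_exp by (intro continuous_intros continuous_on_scaleC_left)
qed (use assms(2) in auto)

text \<open>On the complex line in direction \<open>h\<close> the Laplacian is the sum of the second derivatives along \<open>h\<close> and
  \<open>i h\<close>, which is four times the Levi form at \<open>h\<close>; this is where the factor 4 comes from.\<close>
lemma circle_mean_lower_bound:
  fixes u :: "'a::complex_hilbert_space \<Rightarrow> real" and u'' :: "'a \<Rightarrow> 'a \<Rightarrow>\<^sub>L 'a \<Rightarrow>\<^sub>L real"
  assumes u': "\<And>w. w \<in> S \<Longrightarrow> (u has_derivative blinfun_apply (u' w)) (at w)"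
    and u'': "\<And>w. w \<in> S \<Longrightarrow> (u' has_derivative blinfun_apply (u'' w)) (at w)"
    and cont: "continuous_on S u''"
    and disc: "\<And>c. cmod c \<le> 1 \<Longrightarrow> z + c *\<^sub>C h \<in> S"
    and lower: "\<And>w. w \<in> S \<Longrightarrow> 4 * c \<le> blinfun_apply (blinfun_apply (u'' w) h) h
      + blinfun_apply (blinfun_apply (u'' w) (\<i> *\<^sub>C h)) (\<i> *\<^sub>C h)"
  shows "ereal (u z + c) \<le> circle_mean (\<lambda>w. ereal (u w)) z h"
proof -
  have "continuous_on S u"
    by (auto intro!: continuous_at_imp_continuous_on has_derivative_continuous u')
  then have cm: "circle_mean (\<lambda>w. ereal (u w)) z h = ereal (integral {0..2*pi} (\<lambda>\<theta>. u (z + cis \<theta> *\<^sub>C h)) / (2*pi))"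
    by (intro circle_mean_continuous continuous_on_circle[where S = S] disc)
  have "2 * pi * u z + pi / 2 * (4 * c) \<le> integral {0..2*pi} (\<lambda>\<theta>. u (z + (cos \<theta> *\<^sub>R h + sin \<theta> *\<^sub>R (\<i> *\<^sub>C h))))"
  proof (rule circle_integral_lower_bound[OF u' u'' cont _ lower])
    fix x y :: real assume "x\<^sup>2 + y\<^sup>2 \<le> 1"
    then have "cmod (Complex x y) \<le> 1" by (simp add: cmod_def)
    from disc[OF this] show "z + x *\<^sub>R h + y *\<^sub>R (\<i> *\<^sub>C h) \<in> S"
      by (simp add: scaleC_Re_Im[of "Complex x y"] add.assoc)
  qed
  then show ?thesis unfolding cm by (simp add: scaleC_Re_Im[of "cis _"] field_simps)
qed

text \<open>If the Levi form were negative at \<open>z\<close>, it would be so near \<open>z\<close> by continuity; then \<open>- u\<close> exceeds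
  its value at \<open>z\<close> in the mean over a small circle, against the sub-mean value inequality for \<open>u\<close>.\<close>
lemma levi_nonneg_of_psh:
  fixes u :: "'a::complex_hilbert_space \<Rightarrow> real" and u'' :: "'a \<Rightarrow> 'a \<Rightarrow>\<^sub>L 'a \<Rightarrow>\<^sub>L real"
  assumes "open S" and z: "z \<in> S"
    and u': "\<And>w. w \<in> S \<Longrightarrow> (u has_derivative blinfun_apply (u' w)) (at w)"
    and u'': "\<And>w. w \<in> S \<Longrightarrow> (u' has_derivative blinfun_apply (u'' w)) (at w)"
    and cont: "continuous_on S u''"
    and psh: "psh_on S (\<lambda>w. ereal (u w))"
  shows "0 \<le> blinfun_apply (blinfun_apply (u'' z) h) h
      + blinfun_apply (blinfun_apply (u'' z) (\<i> *\<^sub>C h)) (\<i> *\<^sub>C h)"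
proof (rule ccontr)
  define L where "L w = blinfun_apply (blinfun_apply (u'' w) h) h
      + blinfun_apply (blinfun_apply (u'' w) (\<i> *\<^sub>C h)) (\<i> *\<^sub>C h)" for w
  assume "\<not> ?thesis"
  then have neg: "L z < 0" by (simp add: L_def)
  have "continuous_on S L" unfolding L_def by (intro continuous_intros cont)
  then have "isCont L z" using \<open>open S\<close> z continuous_on_eq_continuous_at by blast
  then have "(L \<longlongrightarrow> L z) (nhds z)" using tendsto_at_iff_tendsto_nhds[of L z] by (simp add: isCont_def)
  then have "\<forall>\<^sub>F w in nhds z. L w < L z / 2" by (rule order_tendstoD) (use neg in simp)
  with eventually_nhds_in_open[OF \<open>open S\<close> z] have "\<forall>\<^sub>F w in nhds z. w \<in> S \<and> L w < L z / 2"
    by (rule eventually_conj)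
  then obtain d where d: "d > 0" and near: "\<And>w. dist w z < d \<Longrightarrow> w \<in> S \<and> L w < L z / 2"
    unfolding eventually_nhds_metric by blast
  define r where "r = d / (norm h + 1)"
  have r: "r > 0" "norm (r *\<^sub>R h) < d"
    using d by (auto simp: r_def field_simps add_pos_nonneg)
  have sub: "ball z d \<subseteq> S" using near by (auto simp: dist_commute)
  have disc: "z + c *\<^sub>C (r *\<^sub>R h) \<in> ball z d" if "cmod c \<le> 1" for c
  proof -
    have "norm (c *\<^sub>C (r *\<^sub>R h)) \<le> 1 * norm (r *\<^sub>R h)"
      unfolding norm_scaleC by (rule mult_right_mono[OF that]) simp
    then show ?thesis using r by (simp add: dist_norm)
  qed
  \<comment> \<open>A quarter of a lower bound, near \<open>z\<close>, for the sum of the second derivatives of \<open>- u\<close> along \<open>r h\<close> and \<open>i r h\<close>.\<close>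
  define \<delta> where "\<delta> = - (r\<^sup>2 * (L z / 2)) / 4"
  have \<delta>: "\<delta> > 0" using neg r by (simp add: \<delta>_def mult_pos_neg)
  have "ereal (- u z + \<delta>) \<le> circle_mean (\<lambda>w. ereal (- u w)) z (r *\<^sub>R h)"
  proof (rule circle_mean_lower_bound[where u' = "\<lambda>w. - u' w" and u'' = "\<lambda>w. - u'' w" and S = "ball z d"])
    fix w assume w: "w \<in> ball z d"
    then have wS: "w \<in> S" using sub by blast
    show "((\<lambda>w. - u w) has_derivative blinfun_apply (- u' w)) (at w)"
      using has_derivative_minus[OF u'[OF wS]] by (simp add: uminus_blinfun.rep_eq)
    show "((\<lambda>w. - u' w) has_derivative blinfun_apply (- u'' w)) (at w)"
      using has_derivative_minus[OF u''[OF wS]] by (simp add: uminus_blinfun.rep_eq)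
    have "\<i> *\<^sub>C (r *\<^sub>R h) = r *\<^sub>R (\<i> *\<^sub>C h)"
      by (simp add: scaleR_scaleC scaleC_scaleC mult.commute)
    moreover have "r\<^sup>2 * L w \<le> r\<^sup>2 * (L z / 2)"
      using near[of w] w by (intro mult_left_mono) (auto simp: dist_commute)
    ultimately show "4 * \<delta> \<le> blinfun_apply (blinfun_apply (- u'' w) (r *\<^sub>R h)) (r *\<^sub>R h) +
      blinfun_apply (blinfun_apply (- u'' w) (\<i> *\<^sub>C r *\<^sub>R h)) (\<i> *\<^sub>C r *\<^sub>R h)"
      by (simp add: \<delta>_def L_def blinfun.minus_left blinfun.scaleR_left blinfun.scaleR_right power2_eq_square algebra_simps)
  qed (use disc cont sub in \<open>auto intro!: continuous_intros intro: continuous_on_subset\<close>)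
  moreover have "ereal (u z) \<le> circle_mean (\<lambda>w. ereal (u w)) z (r *\<^sub>R h)"
    using psh z disc sub unfolding psh_on_def by blast
  moreover have "continuous_on S u"
    by (auto intro!: continuous_at_imp_continuous_on has_derivative_continuous u')
  then have cc: "continuous_on {0..2*pi} (\<lambda>\<theta>. u (z + cis \<theta> *\<^sub>C (r *\<^sub>R h)))"
    by (rule continuous_on_circle) (use disc sub in blast)
  ultimately show False using \<delta>
    by (simp add: circle_mean_continuous[OF cc] circle_mean_continuous[OF continuous_on_minus[OF cc]])
qed

lemma psh_on_continuous:
  fixes v :: "'a::complex_hilbert_space \<Rightarrow> real"
  assumes cont: "continuous_on S v"
    and mean: "\<And>z h. z \<in> S \<Longrightarrow> (\<And>c. cmod c \<le> 1 \<Longrightarrow> z + c *\<^sub>C h \<in> S) \<Longrightarrow> ereal (v z) \<le> circle_mean (\<lambda>w. ereal (v w)) z h"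
  shows "psh_on S (\<lambda>w. ereal (v w))"
  unfolding psh_on_def
proof (intro conjI ballI allI impI)
  have "continuous_on S (\<lambda>w. ereal (v w))" by (intro continuous_intros cont)
  then have "openin (top_of_set S) (S \<inter> (\<lambda>w. ereal (v w)) -` {..<c})" for c
    by (rule continuous_openin_preimage_gen) simp
  then show "upper_semicontinuous_on S (\<lambda>w. ereal (v w))"
    by (simp add: upper_semicontinuous_on_def vimage_def Int_def)
  fix C assume "C \<in> components S"
  then show "\<exists>z\<in>C. ereal (v z) \<noteq> - \<infinity>" using in_components_nonempty by fastforce
qed (use mean in auto)

text \<open>On the slice of the closure by the complex line through \<open>z\<close> in direction \<open>k\<close>, which is compact, the maximum
  is attained. At a point of \<open>S\<close> it would contradict the strict sub-mean value inequality on a small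
  disc in that line.\<close>
lemma maximum_principle:
  fixes w :: "'a::complex_hilbert_space \<Rightarrow> real"
  assumes nz: "(k::'a) \<noteq> 0" and "open S" "bounded S"
    and cont: "continuous_on (closure S) w"
    and mean: "\<And>z h. z \<in> S \<Longrightarrow> h \<noteq> 0 \<Longrightarrow> (\<And>c. cmod c \<le> 1 \<Longrightarrow> z + c *\<^sub>C h \<in> S) \<Longrightarrow>
      ereal (w z) < circle_mean (\<lambda>w'. ereal (w w')) z h"
    and bound: "\<And>z. z \<in> frontier S \<Longrightarrow> w z \<le> b" and z: "z \<in> S"
  shows "w z \<le> b"
proof -
  define K where "K = {c. z + c *\<^sub>C k \<in> closure S}"
  have cl: "continuous_on UNIV (\<lambda>c. z + c *\<^sub>C k)"
    by (intro continuous_intros continuous_on_scaleC_left)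
  have "closed K"
    using continuous_closed_vimage[OF closed_closure, of "\<lambda>c. z + c *\<^sub>C k"] cl
    by (simp add: K_def vimage_def continuous_on_eq_continuous_at)
  moreover have "bounded K"
  proof -
    obtain R where R: "\<And>x. x \<in> closure S \<Longrightarrow> norm x \<le> R"
      using bounded_closure[OF \<open>bounded S\<close>] by (auto simp: bounded_iff)
    have "cmod c \<le> (R + norm z) / norm k" if "c \<in> K" for c
    proof -
      have "norm (c *\<^sub>C k) \<le> norm (z + c *\<^sub>C k) + norm z" 
        using norm_triangle_ineq4[of "z + c *\<^sub>C k" z] by simp
      also have "\<dots> \<le> R + norm z" using R that by (simp add: K_def)
      finally show ?thesis using nz by (simp add: norm_scaleC field_simps)
    qed
    then show ?thesis by (auto simp: bounded_iff)
  qed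
  ultimately have "compact K" by (simp add: compact_eq_bounded_closed)
  moreover have "0 \<in> K" using z closure_subset scaleR_scaleC[of 0 k] by (auto simp: K_def)
  moreover have "continuous_on K (\<lambda>c. w (z + c *\<^sub>C k))"
    by (rule continuous_on_compose2[OF cont]) (auto simp: K_def intro: continuous_on_subset[OF cl])
  ultimately obtain m where m: "m \<in> K" and max: "\<And>c. c \<in> K \<Longrightarrow> w (z + c *\<^sub>C k) \<le> w (z + m *\<^sub>C k)"
    using continuous_attains_sup[of K] by (metis empty_iff)
  define y where "y = z + m *\<^sub>C k"
  have "w z \<le> w y" using max[OF \<open>0 \<in> K\<close>] scaleR_scaleC[of 0 k] by (simp add: y_def)
  moreover have "y \<in> frontier S"
  proof (rule ccontr)
    assume "y \<notin> frontier S"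
    then have "y \<in> S" using m \<open>open S\<close> by (simp add: K_def y_def frontier_def interior_open)
    then obtain d where d: "d > 0" "cball y d \<subseteq> S" using \<open>open S\<close> open_contains_cball by blast
    define h where "h = (d / norm k) *\<^sub>R k"
    have h: "h \<noteq> 0" "norm h = d" using d nz by (auto simp: h_def)
    have disc: "y + c *\<^sub>C h \<in> S" if "cmod c \<le> 1" for c
      using d mult_right_mono[OF that, of d] by (auto simp: norm_scaleC h dist_norm subset_iff)
    have cc: "continuous_on {0..2*pi} (\<lambda>\<theta>. w (y + cis \<theta> *\<^sub>C h))"
      by (rule continuous_on_circle[OF continuous_on_subset[OF cont closure_subset] disc])
    have "w (y + cis \<theta> *\<^sub>C h) \<le> w y" for \<theta>
    proof -
      define c where "c = m + cis \<theta> * complex_of_real (d / norm k)"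
      have c: "y + cis \<theta> *\<^sub>C h = z + c *\<^sub>C k"
        by (simp add: y_def h_def c_def scaleR_scaleC scaleC_scaleC scaleC_add_left)
      have "y + cis \<theta> *\<^sub>C h \<in> closure S" using disc[of "cis \<theta>"] closure_subset by auto
      then have "c \<in> K" unfolding c K_def by simp
      then show ?thesis using max unfolding c unfolding y_def by simp
    qed
    then have "integral {0..2*pi} (\<lambda>\<theta>. w (y + cis \<theta> *\<^sub>C h)) \<le> integral {0..2*pi} (\<lambda>\<theta>. w y)"
      by (intro integral_le integrable_continuous_interval cc) auto
    then have "circle_mean (\<lambda>w'. ereal (w w')) y h \<le> ereal (w y)"
      by (simp add: circle_mean_continuous[OF cc] field_simps)
    then show False using mean[OF \<open>y \<in> S\<close> h(1) disc] by simp
  qed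
  ultimately show ?thesis using bound by fastforce
qed

section \<open>Comparison with the squared norm\<close>

lemma C2_on_closureD:
  assumes "C2_on_closure \<Omega> u"
  shows "\<And>w. w \<in> \<Omega> \<Longrightarrow> (u has_derivative blinfun_apply (frechet_diff u w)) (at w)"
    and "\<And>w. w \<in> \<Omega> \<Longrightarrow> (frechet_diff u has_derivative blinfun_apply (frechet_diff2 u w)) (at w)"
    and "continuous_on \<Omega> (frechet_diff2 u)"
    and "continuous_on (closure \<Omega>) u"
proof -
  have fd: "(f has_derivative blinfun_apply (frechet_diff f w)) (at w)" if "f differentiable (at w)"
    for f :: "'x::real_normed_vector \<Rightarrow> 'y::real_normed_vector" and w
    using that[unfolded frechet_derivative_works]
    by (simp add: frechet_diff_def bounded_linear_Blinfun_apply[OF has_derivative_bounded_linear[OF that[unfolded frechet_derivative_works]]])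
  show "(u has_derivative blinfun_apply (frechet_diff u w)) (at w)" if "w \<in> \<Omega>" for w
    by (rule fd) (use assms that in \<open>simp add: C2_on_closure_def\<close>)
  show "(frechet_diff u has_derivative blinfun_apply (frechet_diff2 u w)) (at w)" if "w \<in> \<Omega>" for w
    unfolding frechet_diff2_def by (rule fd) (use assms that in \<open>simp add: C2_on_closure_def\<close>)
  show "continuous_on (closure \<Omega>) u" using assms by (simp add: C2_on_closure_def)
  obtain g where "continuous_on (closure \<Omega>) g" "\<forall>z\<in>\<Omega>. g z = frechet_diff2 u z"
    using assms by (auto simp: C2_on_closure_def)
  then show "continuous_on \<Omega> (frechet_diff2 u)"
    by (metis (no_types, lifting) closure_subset continuous_on_cong continuous_on_subset)
qed

text \<open>Subtracting \<open>\<kappa> \<parallel>w\<parallel>\<^sup>2\<close> lowers the Levi form by \<open>\<kappa> \<parallel>h\<parallel>\<^sup>2\<close>. The case \<open>\<kappa> = 1\<close> gives plurisubharmonicity, and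
  \<open>\<kappa> < 1\<close> a strict inequality for the maximum principle.\<close>
lemma circle_mean_minus_norm_sq_lower_bound:
  fixes u :: "'a::complex_hilbert_space \<Rightarrow> real" and u'' :: "'a \<Rightarrow> 'a \<Rightarrow>\<^sub>L 'a \<Rightarrow>\<^sub>L real"
  assumes u': "\<And>w. w \<in> S \<Longrightarrow> (u has_derivative blinfun_apply (u' w)) (at w)"
    and u'': "\<And>w. w \<in> S \<Longrightarrow> (u' has_derivative blinfun_apply (u'' w)) (at w)"
    and cont: "continuous_on S u''"
    and disc: "\<And>c. cmod c \<le> 1 \<Longrightarrow> z + c *\<^sub>C h \<in> S"
    and lower: "\<And>w. w \<in> S \<Longrightarrow> 4 * (norm h)\<^sup>2 \<le> blinfun_apply (blinfun_apply (u'' w) h) h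
      + blinfun_apply (blinfun_apply (u'' w) (\<i> *\<^sub>C h)) (\<i> *\<^sub>C h)"
  shows "ereal (u z - \<kappa> * (norm z)\<^sup>2 + (1 - \<kappa>) * (norm h)\<^sup>2) \<le> circle_mean (\<lambda>w. ereal (u w - \<kappa> * (norm w)\<^sup>2)) z h"
proof (rule circle_mean_lower_bound[where S = S])
  let ?I = "Blinfun (blinfun_inner_right :: 'a \<Rightarrow> 'a \<Rightarrow>\<^sub>L real)"
  fix w assume w: "w \<in> S"
  have "((\<lambda>w. u w - \<kappa> * inner w w) has_derivative (\<lambda>y. blinfun_apply (u' w) y - \<kappa> * (inner w y + inner y w))) (at w)"
    by (intro derivative_intros u'[OF w]) 
  then show "((\<lambda>w. u w - \<kappa> * (norm w)\<^sup>2) has_derivative blinfun_apply (u' w - (2 * \<kappa>) *\<^sub>R blinfun_inner_right w)) (at w)"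
    by (simp add: power2_norm_eq_inner minus_blinfun.rep_eq scaleR_blinfun.rep_eq inner_commute algebra_simps)
  have "((\<lambda>w. u' w - (2 * \<kappa>) *\<^sub>R blinfun_inner_right w) has_derivative
      (\<lambda>y. blinfun_apply (u'' w) y - (2 * \<kappa>) *\<^sub>R blinfun_inner_right y)) (at w)"
    by (intro derivative_intros u''[OF w] bounded_linear_imp_has_derivative bounded_linear_blinfun_inner_right)
  then show "((\<lambda>w. u' w - (2 * \<kappa>) *\<^sub>R blinfun_inner_right w) has_derivative
      blinfun_apply (u'' w - (2 * \<kappa>) *\<^sub>R ?I)) (at w)"
    by (simp add: minus_blinfun.rep_eq scaleR_blinfun.rep_eq bounded_linear_Blinfun_apply[OF bounded_linear_blinfun_inner_right])
  have "inner (\<i> *\<^sub>C h) (\<i> *\<^sub>C h) = (norm h)\<^sup>2"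
    by (simp add: power2_norm_eq_inner[symmetric] norm_scaleC)
  then show "4 * ((1 - \<kappa>) * (norm h)\<^sup>2) \<le> blinfun_apply (blinfun_apply (u'' w - (2 * \<kappa>) *\<^sub>R ?I) h) h
      + blinfun_apply (blinfun_apply (u'' w - (2 * \<kappa>) *\<^sub>R ?I) (\<i> *\<^sub>C h)) (\<i> *\<^sub>C h)"
    using lower[OF w]
    by (simp add: blinfun.diff_left blinfun.scaleR_left bounded_linear_Blinfun_apply[OF bounded_linear_blinfun_inner_right]
       power2_norm_eq_inner[symmetric] algebra_simps)
qed (use disc cont in \<open>auto intro!: continuous_intros\<close>)

theorem theorem6p3:
  fixes \<Omega> :: "'a::complex_hilbert_space set" and u :: "'a \<Rightarrow> real"
  assumes nonzero: "\<exists>v::'a. v \<noteq> 0"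
    and domain: "open \<Omega>" "connected \<Omega>" "\<Omega> \<noteq> {}" "bounded \<Omega>"
    and psh: "psh_on \<Omega> (\<lambda>z. ereal (u z))"
    and C2: "C2_on_closure \<Omega> u"
    and bdd: "bounded (u ` closure \<Omega>)"
    and boundary: "\<And>z. z \<in> frontier \<Omega> \<Longrightarrow> u z \<le> (norm z)\<^sup>2"
    and det: "\<And>z x. z \<in> \<Omega> \<Longrightarrow> norm x = 1 \<Longrightarrow>
        1 = fujii_seo_det x id_blinfun \<and>
        fujii_seo_det x id_blinfun = fujii_seo_det x (levi_op (\<lambda>w. (norm w)\<^sup>2) z) \<and>
        fujii_seo_det x (levi_op (\<lambda>w. (norm w)\<^sup>2) z) \<le> fujii_seo_det x (levi_op u z)"
  shows "psh_on \<Omega> (\<lambda>z. ereal (u z - (norm z)\<^sup>2)) \<and> (\<forall>z\<in>\<Omega>. u z - (norm z)\<^sup>2 \<le> 0)"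
proof -
  note C2' = C2_on_closureD[OF C2]
  \<comment> \<open>The operator inequality \<open>D'D''u \<ge> I\<close> in terms of second derivatives.\<close>
  have levi: "4 * (norm h)\<^sup>2 \<le> blinfun_apply (blinfun_apply (frechet_diff2 u z) h) h
      + blinfun_apply (blinfun_apply (frechet_diff2 u z) (\<i> *\<^sub>C h)) (\<i> *\<^sub>C h)" if z: "z \<in> \<Omega>" for z h
  proof (cases "h = 0")
    case False
    define A where "A = levi_op u z"
    define x where "x = (1 / norm h) *\<^sub>R h"
    have x: "norm x = 1" using False by (simp add: x_def)
    have "symmetric_op A"
      unfolding symmetric_op_def A_def
      by (simp add: inner_levi_op inner_commute[of _ "blinfun_apply (levi_op u z) _"]
          second_derivative_symmetric[OF domain(1) z C2'(1-3)])
    moreover have "0 \<le> inner (blinfun_apply A y) y" for y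
      unfolding A_def inner_levi_op using levi_nonneg_of_psh[OF domain(1) z C2'(1-3) psh, of y] by simp
    moreover have "1 \<le> fujii_seo_det x A" using det[OF z x] by (simp add: A_def)
    ultimately have "1 \<le> inner (blinfun_apply A x) x" using fujii_seo_det_ge_1D x by blast
    also have "\<dots> = inner (blinfun_apply A h) h / (norm h)\<^sup>2"
      by (simp add: x_def blinfun.scaleR_right power2_eq_square)
    finally have "(norm h)\<^sup>2 \<le> inner (blinfun_apply A h) h" using False by (simp add: field_simps)
    then show ?thesis by (simp add: A_def inner_levi_op)
  qed (use levi_nonneg_of_psh[OF domain(1) z C2'(1-3) psh, of h] in simp)
  have mean: "ereal (u z - \<kappa> * (norm z)\<^sup>2 + (1 - \<kappa>) * (norm h)\<^sup>2)
      \<le> circle_mean (\<lambda>w. ereal (u w - \<kappa> * (norm w)\<^sup>2)) z h"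
    if "\<And>c. cmod c \<le> 1 \<Longrightarrow> z + c *\<^sub>C h \<in> \<Omega>" for z h \<kappa>
    using C2'(1-3) that levi by (rule circle_mean_minus_norm_sq_lower_bound)
  have cont: "continuous_on (closure \<Omega>) (\<lambda>z. u z - \<kappa> * (norm z)\<^sup>2)" for \<kappa>
    by (intro continuous_intros C2'(4))
  have "psh_on \<Omega> (\<lambda>z. ereal (u z - (norm z)\<^sup>2))"
  proof (rule psh_on_continuous)
    show "continuous_on \<Omega> (\<lambda>z. u z - (norm z)\<^sup>2)"
      using continuous_on_subset[OF cont[of 1] closure_subset] by simp
    show "ereal (u z - (norm z)\<^sup>2) \<le> circle_mean (\<lambda>z. ereal (u z - (norm z)\<^sup>2)) z h"
      if "\<And>c. cmod c \<le> 1 \<Longrightarrow> z + c *\<^sub>C h \<in> \<Omega>" for z h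
      using mean[OF that, where \<kappa> = 1] by simp
  qed
  moreover have "u z - (norm z)\<^sup>2 \<le> 0" if z: "z \<in> \<Omega>" for z
  proof -
    \<comment> \<open>On the boundary \<open>u - (1 - \<epsilon>) \<parallel>z\<parallel>\<^sup>2 \<le> \<epsilon> \<parallel>z\<parallel>\<^sup>2 \<le> \<epsilon> R\<^sup>2\<close>; then \<open>\<epsilon>\<close> tends to 0.\<close>
    obtain R where R: "\<And>w. w \<in> closure \<Omega> \<Longrightarrow> norm w \<le> R"
      using bounded_closure[OF domain(4)] by (auto simp: bounded_iff)
    obtain k :: 'a where k: "k \<noteq> 0" using nonzero by blast
    have *: "u z - (1 - \<epsilon>) * (norm z)\<^sup>2 \<le> \<epsilon> * R\<^sup>2" if \<epsilon>: "\<epsilon> > 0" for \<epsilon>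
    proof (rule maximum_principle[OF k domain(1,4) cont _ _ z])
      fix y h assume "h \<noteq> (0::'a)" and disc: "\<And>c. cmod c \<le> 1 \<Longrightarrow> y + c *\<^sub>C h \<in> \<Omega>"
      then have "ereal (u y - (1 - \<epsilon>) * (norm y)\<^sup>2) < ereal (u y - (1 - \<epsilon>) * (norm y)\<^sup>2 + (1 - (1 - \<epsilon>)) * (norm h)\<^sup>2)"
        using \<epsilon> by simp
      also note mean[OF disc]
      finally show "ereal (u y - (1 - \<epsilon>) * (norm y)\<^sup>2) < circle_mean (\<lambda>w. ereal (u w - (1 - \<epsilon>) * (norm w)\<^sup>2)) y h" .
    next
      fix y assume y: "y \<in> frontier \<Omega>"
      then have "norm y \<le> R" using R by (auto simp: frontier_def)
      then have "\<epsilon> * (norm y)\<^sup>2 \<le> \<epsilon> * R\<^sup>2" using \<epsilon> by (intro mult_left_mono power_mono) auto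
      then show "u y - (1 - \<epsilon>) * (norm y)\<^sup>2 \<le> \<epsilon> * R\<^sup>2" using boundary[OF y] by (simp add: algebra_simps)
    qed
    have lim: "((\<lambda>\<epsilon>. u z - (1 - \<epsilon>) * (norm z)\<^sup>2) \<longlongrightarrow> u z - (1 - 0) * (norm z)\<^sup>2) (at_right 0)"
      "((\<lambda>\<epsilon>. \<epsilon> * R\<^sup>2) \<longlongrightarrow> 0 * R\<^sup>2) (at_right 0)"
      by (intro tendsto_intros)+
    have "u z - (1 - 0) * (norm z)\<^sup>2 \<le> 0 * R\<^sup>2"
      by (rule tendsto_le[OF _ lim(2,1)]) (auto intro!: eventually_at_rightI[of 0 1] *)
    then show ?thesis by simp
  qed
  ultimately show ?thesis by blast
qed

end
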